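(* Consider the infinite-horizon symmetric Cobb–Douglas economy with perfectly reversible public good contributions described in the context, with $\psi_c(t)=e^{-rt}$ and $\psi_x(t)=e^{-rt}\mathcal{E}_x(t)\equiv e^{-rt+\sigma W(t)}$, $\sigma>0$, for a one-dimensional Brownian motion $W$ and some $r$ such that $\sqrt{2r}>\frac{\sigma\alpha}{1-\alpha-\beta}$. Let $c_*=\sum_ic^i_*$ be the aggregate contribution of the social planner's optimal policy and $\hat c=\sum_i\hat c^i$ the aggregate contribution in the symmetric Nash equilibrium. Then $$\frac{\hat c(t)}{c_*(t)}=\frac{\alpha+\beta}{n\alpha+\beta}$$ ($P\otimes dt$-a.e.) for any $n\ge1$.
   Context: Economy. Horizon $T=\infty$, $n$ agents, filtered probability space $(\Omega,\mathcal{F},\{\mathcal{F}_t\},P)$ satisfying the usual conditions, constant discount rate $r>0$. All agents have the same initial wealth $w_o>0$ and utility $u(x,c)=\frac{x^\alpha c^\beta}{\alpha+\beta}$ with $\alpha,\beta\in(0,1)$, $\alpha+\beta<1$. For $c=\sum_jc^j$, $c^{-i}=\sum_{j\ne i}c^j$, payoffs are $$U^i(x^i,c^i;c^{-i})=E\Big[\int_0^\infty e^{-rt}u(x^i(t),c(t))\,dt\Big].$$ Reversible strategy sets: $$\mathcal{S}_{w_o}:=\Big\{(x^i,c^i):\Omega\times[0,T]\to\mathbb{R}_+^2\text{ optional}:\ E\Big[\int_0^T\psi_x(t)x^i(t)dt+r\int_0^T\psi_c(t)c^i(t)dt\Big]\le w_o\Big\},$$ $$\mathcal{S}_{nw_o}:=\Big\{(\underline{x},\underline{c}):\Omega\times[0,T]\to\mathbb{R}_+^{2n}\text{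 optional}:\ \sum_{i=1}^nE\Big[\int_0^T\psi_x(t)x^i(t)dt+r\int_0^T\psi_c(t)c^i(t)dt\Big]\le nw_o\Big\}.$$ Social planner problem (weights $\gamma^i=1/n$): $\sup_{(\underline{x},\underline{c})\in\mathcal{S}_{nw_o}}\sum_{i=1}^n\gamma^iU^i(x^i,c^i;c^{-i})$, with optimal policy $(\underline{x}_*,\underline{c}_* )$. A tuple $(\hat x^1,\dots,\hat x^n,\hat c^1,\dots,\hat c^n)$ is a Nash equilibrium if for all $i$, $(\hat x^i,\hat c^i)\in\mathcal{S}_{w_o}$ and $U^i(\hat x^i,\hat c^i;\hat c^{-i})=\sup_{(x^i,c^i)\in\mathcal{S}_{w_o}}U^i(x^i,c^i;\hat c^{-i})$; it is symmetric if $(\hat x^i,\hat c^i)$ does not depend on $i$. *)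

theory Defs
  imports "HOL-Probability.Probability"
begin

text \<open>
  Processes are functions \<^typ>\<open>real \<Rightarrow> 'a \<Rightarrow> real\<close>, time first; only times in
  \<open>{0..}\<close> are meaningful, and everything below is guarded accordingly.
\<close>

locale usual_filtered_prob_space = prob_space M + complete_measure M
  for M :: "'a measure" +
  fixes F :: "real \<Rightarrow> 'a measure"
  assumes subalgebra_F: "\<And>t. 0 \<le> t \<Longrightarrow> subalgebra M (F t)"
    and mono_F: "\<And>s t. 0 \<le> s \<Longrightarrow> s \<le> t \<Longrightarrow> sets (F s) \<subseteq> sets (F t)"
    and right_continuous_F: "\<And>t. 0 \<le> t \<Longrightarrow> sets (F t) = (\<Inter>s\<in>{t<..}. sets (F s))"
    and null_sets_F: "null_sets M \<subseteq> sets (F 0)"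

definition adapted :: "(real \<Rightarrow> 'a measure) \<Rightarrow> (real \<Rightarrow> 'a \<Rightarrow> real) \<Rightarrow> bool" where
  "adapted F X \<longleftrightarrow> (\<forall>t\<ge>0. X t \<in> borel_measurable (F t))"

definition cadlag :: "(real \<Rightarrow> real) \<Rightarrow> bool" where
  "cadlag f \<longleftrightarrow>
     (\<forall>t\<ge>0. (f \<longlongrightarrow> f t) (at_right t)) \<and> (\<forall>t>0. \<exists>l. (f \<longlongrightarrow> l) (at_left t))"

definition optional_sigma :: "'a measure \<Rightarrow> (real \<Rightarrow> 'a measure) \<Rightarrow> ('a \<times> real) measure" where
  "optional_sigma M F = sigma (space M \<times> {0..})
     {{p \<in> space M \<times> {0..}. X (snd p) (fst p) \<in> B} | X B.
        adapted F X \<and> (\<forall>\<omega>\<in>space M. cadlag (\<lambda>t. X t \<omega>)) \<and> B \<in> sets borel}"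

definition optional :: "'a measure \<Rightarrow> (real \<Rightarrow> 'a measure) \<Rightarrow> (real \<Rightarrow> 'a \<Rightarrow> real) \<Rightarrow> bool" where
  "optional M F X \<longleftrightarrow> (\<lambda>p. X (snd p) (fst p)) \<in> borel_measurable (optional_sigma M F)"

definition optional_nonneg :: "'a measure \<Rightarrow> (real \<Rightarrow> 'a measure) \<Rightarrow> (real \<Rightarrow> 'a \<Rightarrow> real) \<Rightarrow> bool" where
  "optional_nonneg M F X \<longleftrightarrow> optional M F X \<and> (\<forall>\<omega>\<in>space M. \<forall>t\<ge>0. 0 \<le> X t \<omega>)"

text \<open>Brownian motion with respect to the filtration \<open>F\<close>, started at 0.\<close>

definition brownian_motion ::
    "'a measure \<Rightarrow> (real \<Rightarrow> 'a measure) \<Rightarrow> (real \<Rightarrow> 'a \<Rightarrow> real) \<Rightarrow> bool" where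
  "brownian_motion M F W \<longleftrightarrow>
     adapted F W \<and>
     (AE \<omega> in M. W 0 \<omega> = 0) \<and>
     (AE \<omega> in M. continuous_on {0..} (\<lambda>t. W t \<omega>)) \<and>
     (\<forall>s t. 0 \<le> s \<and> s < t \<longrightarrow>
        prob_space.indep_set M (sets (F s))
          {(\<lambda>\<omega>. W t \<omega> - W s \<omega>) -` B \<inter> space M | B. B \<in> sets borel} \<and>
        distributed M lborel (\<lambda>\<omega>. W t \<omega> - W s \<omega>) (normal_density 0 (sqrt (t - s))))"

definition utility :: "real \<Rightarrow> real \<Rightarrow> real \<Rightarrow> real \<Rightarrow> real" where
  "utility \<alpha> \<beta> x c = x powr \<alpha> * c powr \<beta> / (\<alpha> + \<beta>)"

text \<open>
  All integrands are nonnegative, so payoffs and costs are extended nonnegative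
  Lebesgue integrals. In \<open>payoff\<close> the last argument is the aggregate
  contribution of the other agents.
\<close>

definition payoff ::
    "'a measure \<Rightarrow> real \<Rightarrow> real \<Rightarrow> real \<Rightarrow> (real \<Rightarrow> 'a \<Rightarrow> real) \<Rightarrow> (real \<Rightarrow> 'a \<Rightarrow> real) \<Rightarrow>
     (real \<Rightarrow> 'a \<Rightarrow> real) \<Rightarrow> ennreal" where
  "payoff M r \<alpha> \<beta> x c c_others =
     (\<integral>\<^sup>+\<omega>. (\<integral>\<^sup>+t\<in>{0..}.
        ennreal (exp (- r * t) * utility \<alpha> \<beta> (x t \<omega>) (c t \<omega> + c_others t \<omega>)) \<partial>lborel) \<partial>M)"

definition cost ::
    "'a measure \<Rightarrow> real \<Rightarrow> (real \<Rightarrow> 'a \<Rightarrow> real) \<Rightarrow> (real \<Rightarrow> 'a \<Rightarrow> real) \<Rightarrow>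
     (real \<Rightarrow> 'a \<Rightarrow> real) \<Rightarrow> (real \<Rightarrow> 'a \<Rightarrow> real) \<Rightarrow> ennreal" where
  "cost M r \<psi>x \<psi>c x c =
     (\<integral>\<^sup>+\<omega>. (\<integral>\<^sup>+t\<in>{0..}. ennreal (\<psi>x t \<omega> * x t \<omega>) \<partial>lborel)
        + ennreal r * (\<integral>\<^sup>+t\<in>{0..}. ennreal (\<psi>c t \<omega> * c t \<omega>) \<partial>lborel) \<partial>M)"

text \<open>Agents are \<open>i < n\<close>; the components of a tuple with index \<open>\<ge> n\<close> are irrelevant.\<close>

definition aggregate :: "nat \<Rightarrow> (nat \<Rightarrow> real \<Rightarrow> 'a \<Rightarrow> real) \<Rightarrow> real \<Rightarrow> 'a \<Rightarrow> real" where
  "aggregate n c t \<omega> = (\<Sum>j<n. c j t \<omega>)"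

definition aggregate_others ::
    "nat \<Rightarrow> nat \<Rightarrow> (nat \<Rightarrow> real \<Rightarrow> 'a \<Rightarrow> real) \<Rightarrow> real \<Rightarrow> 'a \<Rightarrow> real" where
  "aggregate_others n i c t \<omega> = (\<Sum>j\<in>{..<n} - {i}. c j t \<omega>)"

definition agent_strategies ::
    "'a measure \<Rightarrow> (real \<Rightarrow> 'a measure) \<Rightarrow> real \<Rightarrow> (real \<Rightarrow> 'a \<Rightarrow> real) \<Rightarrow> (real \<Rightarrow> 'a \<Rightarrow> real) \<Rightarrow>
     real \<Rightarrow> ((real \<Rightarrow> 'a \<Rightarrow> real) \<times> (real \<Rightarrow> 'a \<Rightarrow> real)) set" where
  "agent_strategies M F r \<psi>x \<psi>c w =
     {(x, c). optional_nonneg M F x \<and> optional_nonneg M F c \<and>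
              cost M r \<psi>x \<psi>c x c \<le> ennreal w}"

definition planner_strategies ::
    "'a measure \<Rightarrow> (real \<Rightarrow> 'a measure) \<Rightarrow> real \<Rightarrow> (real \<Rightarrow> 'a \<Rightarrow> real) \<Rightarrow> (real \<Rightarrow> 'a \<Rightarrow> real) \<Rightarrow>
     nat \<Rightarrow> real \<Rightarrow> ((nat \<Rightarrow> real \<Rightarrow> 'a \<Rightarrow> real) \<times> (nat \<Rightarrow> real \<Rightarrow> 'a \<Rightarrow> real)) set" where
  "planner_strategies M F r \<psi>x \<psi>c n w =
     {(x, c). (\<forall>i<n. optional_nonneg M F (x i) \<and> optional_nonneg M F (c i)) \<and>
              (\<Sum>i<n. cost M r \<psi>x \<psi>c (x i) (c i)) \<le> ennreal w}"

definition welfare ::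
    "'a measure \<Rightarrow> real \<Rightarrow> real \<Rightarrow> real \<Rightarrow> nat \<Rightarrow> (nat \<Rightarrow> real \<Rightarrow> 'a \<Rightarrow> real) \<Rightarrow>
     (nat \<Rightarrow> real \<Rightarrow> 'a \<Rightarrow> real) \<Rightarrow> ennreal" where
  "welfare M r \<alpha> \<beta> n x c =
     (\<Sum>i<n. ennreal (1 / real n) * payoff M r \<alpha> \<beta> (x i) (c i) (aggregate_others n i c))"

definition planner_optimal ::
    "'a measure \<Rightarrow> (real \<Rightarrow> 'a measure) \<Rightarrow> real \<Rightarrow> real \<Rightarrow> real \<Rightarrow>
     (real \<Rightarrow> 'a \<Rightarrow> real) \<Rightarrow> (real \<Rightarrow> 'a \<Rightarrow> real) \<Rightarrow> nat \<Rightarrow> real \<Rightarrow>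
     (nat \<Rightarrow> real \<Rightarrow> 'a \<Rightarrow> real) \<Rightarrow> (nat \<Rightarrow> real \<Rightarrow> 'a \<Rightarrow> real) \<Rightarrow> bool" where
  "planner_optimal M F r \<alpha> \<beta> \<psi>x \<psi>c n w x c \<longleftrightarrow>
     (x, c) \<in> planner_strategies M F r \<psi>x \<psi>c n (real n * w) \<and>
     welfare M r \<alpha> \<beta> n x c =
       (SUP (y, d)\<in>planner_strategies M F r \<psi>x \<psi>c n (real n * w). welfare M r \<alpha> \<beta> n y d)"

definition nash_equilibrium ::
    "'a measure \<Rightarrow> (real \<Rightarrow> 'a measure) \<Rightarrow> real \<Rightarrow> real \<Rightarrow> real \<Rightarrow>
     (real \<Rightarrow> 'a \<Rightarrow> real) \<Rightarrow> (real \<Rightarrow> 'a \<Rightarrow> real) \<Rightarrow> nat \<Rightarrow> real \<Rightarrow>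
     (nat \<Rightarrow> real \<Rightarrow> 'a \<Rightarrow> real) \<Rightarrow> (nat \<Rightarrow> real \<Rightarrow> 'a \<Rightarrow> real) \<Rightarrow> bool" where
  "nash_equilibrium M F r \<alpha> \<beta> \<psi>x \<psi>c n w x c \<longleftrightarrow>
     (\<forall>i<n. (x i, c i) \<in> agent_strategies M F r \<psi>x \<psi>c w \<and>
        payoff M r \<alpha> \<beta> (x i) (c i) (aggregate_others n i c) =
          (SUP (y, d)\<in>agent_strategies M F r \<psi>x \<psi>c w.
             payoff M r \<alpha> \<beta> y d (aggregate_others n i c)))"

definition symmetric_nash_equilibrium ::
    "'a measure \<Rightarrow> (real \<Rightarrow> 'a measure) \<Rightarrow> real \<Rightarrow> real \<Rightarrow> real \<Rightarrow>
     (real \<Rightarrow> 'a \<Rightarrow> real) \<Rightarrow> (real \<Rightarrow> 'a \<Rightarrow> real) \<Rightarrow> nat \<Rightarrow> real \<Rightarrow>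
     (nat \<Rightarrow> real \<Rightarrow> 'a \<Rightarrow> real) \<Rightarrow> (nat \<Rightarrow> real \<Rightarrow> 'a \<Rightarrow> real) \<Rightarrow> bool" where
  "symmetric_nash_equilibrium M F r \<alpha> \<beta> \<psi>x \<psi>c n w x c \<longleftrightarrow>
     nash_equilibrium M F r \<alpha> \<beta> \<psi>x \<psi>c n w x c \<and>
     (\<forall>i<n. \<forall>j<n. \<forall>\<omega>\<in>space M. \<forall>t\<ge>0. x i t \<omega> = x j t \<omega> \<and> c i t \<omega> = c j t \<omega>)"

end

theory Submission
  imports Defs
begin

text \<open>
  With \<open>E = exp (\<sigma> W)\<close> and the measure \<open>e\<^sup>-\<^sup>r\<^sup>t dt \<otimes> P\<close>, the problem of a single decision maker who
  maximises the integral of \<open>x\<^sup>\<alpha> c\<^sup>\<beta>\<close> subject to a budget for the integral of \<open>E x + r c\<close> is solved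
  pointwise. The optimum is explicit and proportional to the budget, \<open>c\<close> being a constant multiple of
  \<open>Z\<close>, the power of \<open>E\<close> with exponent \<open>- \<alpha> / (1 - \<alpha> - \<beta>)\<close>. The assumption on \<open>r\<close> makes \<open>Z\<close>
  integrable, and the equality case of the weighted AM-GM inequality gives uniqueness.

  Both problems reduce to this one. By Jensen's inequality for \<open>x\<^sup>\<alpha>\<close> the planner's aggregates solve
  it with budget \<open>n w\<close>. By concavity a symmetric Nash equilibrium, with the consumption of one agent
  and the aggregate contribution, solves it as well, and its budget is forced to be
  \<open>n w (\<alpha> + \<beta>) / (n \<alpha> + \<beta>)\<close>. The ratio of the aggregate contributions is the ratio of the budgets.
\<close>

section \<open>The tangent inequality for the Cobb-Douglas utility\<close>

lemma young_two_variable: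
  fixes a b \<alpha> \<beta> :: real
  assumes "0 \<le> a" "0 \<le> b" "0 < \<alpha>" "0 < \<beta>" "\<alpha> + \<beta> < 1"
  shows "a powr \<alpha> * b powr \<beta> \<le> \<alpha> * a + \<beta> * b + (1 - \<alpha> - \<beta>)"
    and "a powr \<alpha> * b powr \<beta> = \<alpha> * a + \<beta> * b + (1 - \<alpha> - \<beta>) \<Longrightarrow> a = 1 \<and> b = 1"
proof -
  define S where "S = \<alpha> * a + \<beta> * b + (1 - \<alpha> - \<beta>)"
  have S: "0 < S"
    unfolding S_def using assms by (smt (verit) mult_nonneg_nonneg)
  have "a powr \<alpha> * b powr \<beta> \<le> S \<and> (a powr \<alpha> * b powr \<beta> = S \<longrightarrow> a = 1 \<and> b = 1)"
  proof (cases "a = 0 \<or> b = 0")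
    case True
    then show ?thesis using S by auto
  next
    case False
    then have a: "0 < a" and b: "0 < b" using assms by auto
    define d where "d x = x - 1 - ln x" for x :: real
    have d_nonneg: "0 \<le> d x" if "0 < x" for x
      using ln_le_minus_one[OF that] by (simp add: d_def)
    have d_zero: "x = 1" if "0 < x" "d x = 0" for x
      using ln_eq_minus_one[OF that(1)] that(2) by (simp add: d_def)
    have gap: "ln S - ln (a powr \<alpha> * b powr \<beta>)
        = \<alpha> * d (a / S) + \<beta> * d (b / S) + (1 - \<alpha> - \<beta>) * d (1 / S)"
    proof -
      have "\<alpha> * d (a / S) + \<beta> * d (b / S) + (1 - \<alpha> - \<beta>) * d (1 / S)
          = (\<alpha> * a + \<beta> * b + (1 - \<alpha> - \<beta>)) / S - 1 + ln S - \<alpha> * ln a - \<beta> * ln b"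
        using a b S by (simp add: d_def ln_div field_simps)
      also have "\<dots> = ln S - \<alpha> * ln a - \<beta> * ln b"
        using S by (simp flip: S_def)
      finally show ?thesis
        using a b by (simp add: ln_mult ln_powr)
    qed
    have pos: "0 \<le> d (a / S)" "0 \<le> d (b / S)" "0 \<le> d (1 / S)"
      using a b S by (auto intro!: d_nonneg)
    then have "ln (a powr \<alpha> * b powr \<beta>) \<le> ln S"
      using gap assms by (smt (verit) mult_nonneg_nonneg)
    then have le: "a powr \<alpha> * b powr \<beta> \<le> S"
      using a b S by (subst (asm) ln_le_cancel_iff) auto
    have "a = 1 \<and> b = 1" if "a powr \<alpha> * b powr \<beta> = S"
    proof -
      have nn: "0 \<le> \<alpha> * d (a / S)" "0 \<le> \<beta> * d (b / S)" "0 \<le> (1 - \<alpha> - \<beta>) * d (1 / S)"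
        using pos assms by auto
      moreover have "\<alpha> * d (a / S) + \<beta> * d (b / S) + (1 - \<alpha> - \<beta>) * d (1 / S) = 0"
        using gap that by simp
      ultimately have "\<alpha> * d (a / S) = 0" "\<beta> * d (b / S) = 0" "(1 - \<alpha> - \<beta>) * d (1 / S) = 0"
        by linarith+
      then have "d (a / S) = 0" "d (b / S) = 0" "d (1 / S) = 0"
        using assms by auto
      then have "a / S = 1" "b / S = 1" "1 / S = 1"
        using d_zero[OF divide_pos_pos[OF a S]] d_zero[OF divide_pos_pos[OF b S]]
          d_zero[OF divide_pos_pos[OF zero_less_one S]] by blast+
      then show ?thesis using S by simp
    qed
    with le show ?thesis by blast
  qed
  then show "a powr \<alpha> * b powr \<beta> \<le> \<alpha> * a + \<beta> * b + (1 - \<alpha> - \<beta>)"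
    and "a powr \<alpha> * b powr \<beta> = \<alpha> * a + \<beta> * b + (1 - \<alpha> - \<beta>) \<Longrightarrow> a = 1 \<and> b = 1"
    by (auto simp: S_def)
qed

lemma utility_scale:
  assumes "0 < x0" "0 < c0" "0 \<le> x" "0 \<le> c"
  shows "utility \<alpha> \<beta> x c = utility \<alpha> \<beta> x0 c0 * ((x / x0) powr \<alpha> * (c / c0) powr \<beta>)"
  using assms by (simp add: utility_def powr_divide)

lemma utility_nonneg: "0 < \<alpha> \<Longrightarrow> 0 < \<beta> \<Longrightarrow> 0 \<le> utility \<alpha> \<beta> x c"
  by (simp add: utility_def)

lemma utility_tangent:
  fixes \<alpha> \<beta> :: real
  assumes "0 < \<alpha>" "0 < \<beta>" "\<alpha> + \<beta> < 1" "0 < x0" "0 < c0" "0 \<le> x" "0 \<le> c"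
  shows "utility \<alpha> \<beta> x c \<le> utility \<alpha> \<beta> x0 c0 * (\<alpha> * x / x0 + \<beta> * c / c0 + (1 - \<alpha> - \<beta>))"
    and "utility \<alpha> \<beta> x c = utility \<alpha> \<beta> x0 c0 * (\<alpha> * x / x0 + \<beta> * c / c0 + (1 - \<alpha> - \<beta>))
      \<Longrightarrow> x = x0 \<and> c = c0"
proof -
  have u0: "0 < utility \<alpha> \<beta> x0 c0"
    using assms by (simp add: utility_def)
  have young: "(x / x0) powr \<alpha> * (c / c0) powr \<beta> \<le> \<alpha> * (x / x0) + \<beta> * (c / c0) + (1 - \<alpha> - \<beta>)"
    "(x / x0) powr \<alpha> * (c / c0) powr \<beta> = \<alpha> * (x / x0) + \<beta> * (c / c0) + (1 - \<alpha> - \<beta>)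
      \<Longrightarrow> x / x0 = 1 \<and> c / c0 = 1"
    using young_two_variable[of "x / x0" "c / c0" \<alpha> \<beta>] assms by auto
  show "utility \<alpha> \<beta> x c \<le> utility \<alpha> \<beta> x0 c0 * (\<alpha> * x / x0 + \<beta> * c / c0 + (1 - \<alpha> - \<beta>))"
    unfolding utility_scale[OF assms(4-7)]
    using young(1) u0 by (intro mult_left_mono) auto
  assume "utility \<alpha> \<beta> x c = utility \<alpha> \<beta> x0 c0 * (\<alpha> * x / x0 + \<beta> * c / c0 + (1 - \<alpha> - \<beta>))"
  then have "(x / x0) powr \<alpha> * (c / c0) powr \<beta> = \<alpha> * (x / x0) + \<beta> * (c / c0) + (1 - \<alpha> - \<beta>)"
    unfolding utility_scale[OF assms(4-7)] using u0 by simp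
  then show "x = x0 \<and> c = c0"
    using young(2) assms by simp
qed

lemma utility_concave:
  fixes \<alpha> \<beta> \<epsilon> :: real
  assumes "0 < \<alpha>" "0 < \<beta>" "\<alpha> + \<beta> < 1" "0 < \<epsilon>" "\<epsilon> \<le> 1"
    and "0 \<le> x" "0 \<le> c" "0 < y" "0 < g"
  shows "(1 - \<epsilon>) * utility \<alpha> \<beta> x c + \<epsilon> * utility \<alpha> \<beta> y g
    \<le> utility \<alpha> \<beta> ((1 - \<epsilon>) * x + \<epsilon> * y) ((1 - \<epsilon>) * c + \<epsilon> * g)"
proof -
  define a b where "a = (1 - \<epsilon>) * x + \<epsilon> * y" and "b = (1 - \<epsilon>) * c + \<epsilon> * g"
  have ab: "0 < a" "0 < b"
    unfolding a_def b_def using assms by (auto intro!: add_nonneg_pos)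
  let ?u = "utility \<alpha> \<beta> a b"
  have "(1 - \<epsilon>) * utility \<alpha> \<beta> x c + \<epsilon> * utility \<alpha> \<beta> y g
      \<le> (1 - \<epsilon>) * (?u * (\<alpha> * x / a + \<beta> * c / b + (1 - \<alpha> - \<beta>)))
        + \<epsilon> * (?u * (\<alpha> * y / a + \<beta> * g / b + (1 - \<alpha> - \<beta>)))"
    using assms ab by (intro add_mono mult_left_mono utility_tangent) auto
  also have "\<dots> = ?u * (\<alpha> * ((1 - \<epsilon>) * x + \<epsilon> * y) / a + \<beta> * ((1 - \<epsilon>) * c + \<epsilon> * g) / b
      + (1 - \<alpha> - \<beta>))"
    using ab by (simp add: field_simps)
  also have "\<dots> = ?u"
    using ab by (simp flip: a_def b_def)
  finally show ?thesis by (simp add: a_def b_def)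
qed

lemma utility_jensen:
  fixes \<alpha> \<beta> c :: real and x :: "nat \<Rightarrow> real"
  assumes "0 < \<alpha>" "0 < \<beta>" "\<alpha> + \<beta> < 1" "\<And>i. i < n \<Longrightarrow> 0 \<le> x i" "0 \<le> c"
  shows "(\<Sum>i<n. utility \<alpha> \<beta> (x i) c) \<le> real n * utility \<alpha> \<beta> ((\<Sum>i<n. x i) / real n) c"
proof (cases "(\<Sum>i<n. x i) = 0 \<or> c = 0")
  case True
  then have "\<forall>i<n. utility \<alpha> \<beta> (x i) c = 0"
    using assms sum_nonneg_eq_0_iff[of "{..<n}" x] by (auto simp: utility_def)
  then show ?thesis
    using assms(1,2) by (simp add: utility_nonneg)
next
  case False
  define a where "a = (\<Sum>i<n. x i) / real n"
  have n: "0 < n" using False by (cases n) auto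
  have "0 \<le> (\<Sum>i<n. x i)"
    using assms(4) by (intro sum_nonneg) auto
  then have a: "0 < a" and c: "0 < c"
    using False assms(5) n by (auto simp: a_def)
  have "(\<Sum>i<n. utility \<alpha> \<beta> (x i) c)
      \<le> (\<Sum>i<n. utility \<alpha> \<beta> a c * (\<alpha> * x i / a + \<beta> * c / c + (1 - \<alpha> - \<beta>)))"
    using assms a c by (intro sum_mono utility_tangent) auto
  also have "\<dots> = utility \<alpha> \<beta> a c * (\<Sum>i<n. \<alpha> / a * x i + (1 - \<alpha>))"
    using c by (simp add: sum_distrib_left algebra_simps)
  also have "(\<Sum>i<n. \<alpha> / a * x i + (1 - \<alpha>)) = \<alpha> / a * (\<Sum>i<n. x i) + real n * (1 - \<alpha>)"
    by (simp add: sum.distrib sum_distrib_left)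
  also have "(\<Sum>i<n. x i) = real n * a"
    using n by (simp add: a_def)
  finally show ?thesis
    using a by (simp add: a_def[symmetric] algebra_simps)
qed

lemma utility_divide:
  assumes "0 \<le> x" "0 < k"
  shows "utility \<alpha> \<beta> (x / k) c = k powr (- \<alpha>) * utility \<alpha> \<beta> x c"
  using assms by (simp add: utility_def powr_divide powr_minus field_simps)

section \<open>The single decision maker\<close>

locale cobb_douglas =
  fixes N :: "'b measure" and E :: "'b \<Rightarrow> real" and \<alpha> \<beta> r K :: real
  assumes E_measurable [measurable]: "E \<in> borel_measurable N"
    and E_pos: "\<And>p. 0 < E p"
    and \<alpha>_pos: "0 < \<alpha>" and \<beta>_pos: "0 < \<beta>" and exponents: "\<alpha> + \<beta> < 1" and r_pos: "0 < r"
    and K_pos: "0 < K"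
    and K_eq: "(\<integral>\<^sup>+ p. ennreal (E p powr - (\<alpha> / (1 - \<alpha> - \<beta>))) \<partial>N) = ennreal K"
begin

definition Z :: "'b \<Rightarrow> real" where
  "Z p = E p powr - (\<alpha> / (1 - \<alpha> - \<beta>))"

definition admissible :: "('b \<Rightarrow> real) \<Rightarrow> bool" where
  "admissible y \<longleftrightarrow> y \<in> borel_measurable N \<and> (\<forall>p\<in>space N. 0 \<le> y p)"

definition J :: "('b \<Rightarrow> real) \<Rightarrow> ('b \<Rightarrow> real) \<Rightarrow> ennreal" where
  "J y g = (\<integral>\<^sup>+ p. ennreal (utility \<alpha> \<beta> (y p) (g p)) \<partial>N)"

definition expenditure :: "('b \<Rightarrow> real) \<Rightarrow> ('b \<Rightarrow> real) \<Rightarrow> ennreal" where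
  "expenditure y g = (\<integral>\<^sup>+ p. ennreal (E p * y p + r * g p) \<partial>N)"

text \<open>The first-order conditions make \<open>E * x\<close> and \<open>r * c\<close> proportional to \<open>Z\<close>, with
  expenditure shares \<open>\<alpha> : \<beta>\<close>; the factors below exhaust the budget \<open>m\<close>.\<close>

definition opt_x :: "real \<Rightarrow> 'b \<Rightarrow> real" where
  "opt_x m p = \<alpha> * m / ((\<alpha> + \<beta>) * K) * (Z p / E p)"

definition opt_c :: "real \<Rightarrow> 'b \<Rightarrow> real" where
  "opt_c m p = \<beta> * m / ((\<alpha> + \<beta>) * r * K) * Z p"

definition opt_coeff :: "real \<Rightarrow> real" where
  "opt_coeff m = utility \<alpha> \<beta> (\<alpha> * m / ((\<alpha> + \<beta>) * K)) (\<beta> * m / ((\<alpha> + \<beta>) * r * K))"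

lemma Z_measurable [measurable]: "Z \<in> borel_measurable N"
  unfolding Z_def by measurable

lemma Z_pos: "0 < Z p"
  using E_pos[of p] by (simp add: Z_def)

lemma nn_integral_Z: "(\<integral>\<^sup>+ p. ennreal (Z p) \<partial>N) = ennreal K"
  using K_eq by (simp add: Z_def)

lemma opt_measurable [measurable]:
  "opt_x m \<in> borel_measurable N" "opt_c m \<in> borel_measurable N"
  unfolding opt_x_def[abs_def] opt_c_def[abs_def] by measurable

lemma utility_measurable [measurable]:
  assumes [measurable]: "y \<in> borel_measurable N" "g \<in> borel_measurable N"
  shows "(\<lambda>p. utility \<alpha> \<beta> (y p) (g p)) \<in> borel_measurable N"
  unfolding utility_def by measurable

lemma opt_pos: "0 < m \<Longrightarrow> 0 < opt_x m p" "0 < m \<Longrightarrow> 0 < opt_c m p"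
  using \<alpha>_pos \<beta>_pos r_pos K_pos Z_pos[of p] E_pos[of p] by (auto simp: opt_x_def opt_c_def)

lemma admissible_opt: "0 < m \<Longrightarrow> admissible (opt_x m)" "0 < m \<Longrightarrow> admissible (opt_c m)"
  using opt_pos by (auto simp: admissible_def less_imp_le)

lemma opt_coeff_pos: "0 < m \<Longrightarrow> 0 < opt_coeff m"
  using \<alpha>_pos \<beta>_pos r_pos K_pos by (simp add: opt_coeff_def utility_def)

lemma utility_opt:
  assumes "0 < m"
  shows "utility \<alpha> \<beta> (opt_x m p) (opt_c m p) = opt_coeff m * Z p"
proof -
  have "(Z p / E p) powr \<alpha> * Z p powr \<beta> = Z p"
  proof -
    have "(Z p / E p) powr \<alpha> * Z p powr \<beta> = Z p powr (\<alpha> + \<beta>) * E p powr (- \<alpha>)"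
      using E_pos[of p] Z_pos[of p] by (simp add: powr_divide powr_add powr_minus field_simps)
    also have "\<dots> = E p powr (- (\<alpha> / (1 - \<alpha> - \<beta>)) * (\<alpha> + \<beta>) + - \<alpha>)"
      unfolding Z_def powr_powr by (simp only: powr_add)
    also have "- (\<alpha> / (1 - \<alpha> - \<beta>)) * (\<alpha> + \<beta>) + - \<alpha> = - (\<alpha> / (1 - \<alpha> - \<beta>))"
      using exponents by (simp add: field_simps)
    finally show ?thesis by (simp add: Z_def)
  qed
  moreover have "utility \<alpha> \<beta> (opt_x m p) (opt_c m p)
      = opt_coeff m * ((Z p / E p) powr \<alpha> * Z p powr \<beta>)"
    using assms \<alpha>_pos \<beta>_pos r_pos K_pos Z_pos[of p] E_pos[of p]
    unfolding utility_def opt_x_def opt_c_def opt_coeff_def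
    by (subst (1 2) powr_mult) auto
  ultimately show ?thesis by simp
qed

lemma J_opt: "0 < m \<Longrightarrow> J (opt_x m) (opt_c m) = ennreal (opt_coeff m * K)"
  using opt_coeff_pos[of m] K_pos Z_pos
  by (simp add: J_def utility_opt ennreal_mult' nn_integral_cmult nn_integral_Z)

text \<open>The tangent plane of the utility at \<open>(opt_x m, opt_c m)\<close>, rewritten so that its integral
  depends on \<open>(y, g)\<close> only through the expenditure.\<close>

definition tangent :: "real \<Rightarrow> ('b \<Rightarrow> real) \<Rightarrow> ('b \<Rightarrow> real) \<Rightarrow> 'b \<Rightarrow> real" where
  "tangent m y g p = opt_coeff m * (\<alpha> + \<beta>) * K / m * (E p * y p + r * g p)
     + opt_coeff m * (1 - \<alpha> - \<beta>) * Z p"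

lemma tangent_eq:
  assumes "0 < m"
  shows "tangent m y g p = utility \<alpha> \<beta> (opt_x m p) (opt_c m p)
    * (\<alpha> * y p / opt_x m p + \<beta> * g p / opt_c m p + (1 - \<alpha> - \<beta>))"
proof -
  have "\<alpha> * y p / opt_x m p = (\<alpha> + \<beta>) * K / m * (E p * y p) / Z p"
    "\<beta> * g p / opt_c m p = (\<alpha> + \<beta>) * K / m * (r * g p) / Z p"
    using assms \<alpha>_pos \<beta>_pos r_pos K_pos Z_pos[of p] E_pos[of p]
    by (auto simp: opt_x_def opt_c_def field_simps)
  note ratios = this
  show ?thesis
    unfolding ratios utility_opt[OF assms] tangent_def
    using assms Z_pos[of p] by (simp add: algebra_simps add_divide_distrib)
qed

lemma utility_le_tangent:
  assumes "0 < m" "0 \<le> y p" "0 \<le> g p"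
  shows "utility \<alpha> \<beta> (y p) (g p) \<le> tangent m y g p"
    and "utility \<alpha> \<beta> (y p) (g p) = tangent m y g p \<Longrightarrow> y p = opt_x m p \<and> g p = opt_c m p"
  unfolding tangent_eq[OF assms(1)]
  using utility_tangent[OF \<alpha>_pos \<beta>_pos exponents opt_pos[OF assms(1)] assms(2,3)] by blast+

lemma nn_integral_tangent:
  assumes "0 < m" "admissible y" "admissible g" "expenditure y g \<le> ennreal m"
  shows "(\<integral>\<^sup>+ p. ennreal (tangent m y g p) \<partial>N) \<le> ennreal (opt_coeff m * K)"
proof -
  have [measurable]: "y \<in> borel_measurable N" "g \<in> borel_measurable N"
    and nn: "\<And>p. p \<in> space N \<Longrightarrow> 0 \<le> y p" "\<And>p. p \<in> space N \<Longrightarrow> 0 \<le> g p"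
    using assms by (auto simp: admissible_def)
  define B where "B = opt_coeff m * (\<alpha> + \<beta>) * K / m"
  define D where "D = opt_coeff m * (1 - \<alpha> - \<beta>)"
  have pos: "0 \<le> B" "0 \<le> D"
    using assms(1) \<alpha>_pos \<beta>_pos exponents K_pos opt_coeff_pos[of m] by (auto simp: B_def D_def)
  have "(\<integral>\<^sup>+ p. ennreal (tangent m y g p) \<partial>N)
      = (\<integral>\<^sup>+ p. ennreal B * ennreal (E p * y p + r * g p) + ennreal D * ennreal (Z p) \<partial>N)"
    using nn pos E_pos r_pos Z_pos
    by (intro nn_integral_cong)
      (simp add: tangent_def less_imp_le flip: ennreal_mult ennreal_plus B_def D_def)
  also have "\<dots> = ennreal B * expenditure y g + ennreal D * ennreal K"
    by (simp add: nn_integral_add nn_integral_cmult nn_integral_Z expenditure_def)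
  also have "\<dots> \<le> ennreal B * ennreal m + ennreal D * ennreal K"
    using assms(4) by (intro add_mono mult_left_mono) auto
  also have "\<dots> = ennreal (B * m + D * K)"
    using pos K_pos assms(1) by (simp add: ennreal_mult ennreal_plus)
  also have "B * m + D * K = opt_coeff m * K"
  proof -
    have "B * m = opt_coeff m * (\<alpha> + \<beta>) * K"
      using assms(1) by (simp add: B_def)
    then show ?thesis
      by (simp add: D_def algebra_simps)
  qed
  finally show ?thesis .
qed

lemma J_le_opt:
  assumes "0 < m" "admissible y" "admissible g" "expenditure y g \<le> ennreal m"
  shows "J y g \<le> J (opt_x m) (opt_c m)"
proof -
  have "J y g \<le> (\<integral>\<^sup>+ p. ennreal (tangent m y g p) \<partial>N)"
    unfolding J_def using assms
    by (intro nn_integral_mono ennreal_leI utility_le_tangent) (auto simp: admissible_def)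
  also have "\<dots> \<le> J (opt_x m) (opt_c m)"
    using nn_integral_tangent[OF assms] assms(1) by (simp add: J_opt)
  finally show ?thesis .
qed

lemma opt_unique:
  assumes "0 < m" "admissible y" "admissible g" "expenditure y g \<le> ennreal m"
    and "J (opt_x m) (opt_c m) \<le> J y g"
  shows "AE p in N. y p = opt_x m p \<and> g p = opt_c m p"
proof -
  have [measurable]: "y \<in> borel_measurable N" "g \<in> borel_measurable N"
    and nn: "\<And>p. p \<in> space N \<Longrightarrow> 0 \<le> y p" "\<And>p. p \<in> space N \<Longrightarrow> 0 \<le> g p"
    using assms by (auto simp: admissible_def)
  have [measurable]: "tangent m y g \<in> borel_measurable N"
    unfolding tangent_def by measurable
  have "AE p in N. ennreal (tangent m y g p) \<le> ennreal (utility \<alpha> \<beta> (y p) (g p))"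
  proof (rule ccontr)
    assume *: "\<not> ?thesis"
    have "J y g < (\<integral>\<^sup>+ p. ennreal (tangent m y g p) \<partial>N)"
      unfolding J_def
    proof (rule nn_integral_less)
      have "J y g < \<infinity>"
        using J_le_opt[OF assms(1-4)] J_opt[OF assms(1)] by (auto simp: order.strict_iff_not top_unique)
      then show "(\<integral>\<^sup>+ p. ennreal (utility \<alpha> \<beta> (y p) (g p)) \<partial>N) \<noteq> \<infinity>"
        by (simp add: J_def)
      show "AE p in N. ennreal (utility \<alpha> \<beta> (y p) (g p)) \<le> ennreal (tangent m y g p)"
        using nn assms(1) by (intro AE_I2 ennreal_leI utility_le_tangent) auto
    qed (use * in auto)
    also have "\<dots> \<le> J y g"
      using nn_integral_tangent[OF assms(1-4)] assms(5) J_opt[OF assms(1)] by simp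
    finally show False by simp
  qed
  then show ?thesis
    using AE_space
  proof eventually_elim
    case (elim p)
    have "tangent m y g p \<le> utility \<alpha> \<beta> (y p) (g p)"
      using elim(1) utility_nonneg[OF \<alpha>_pos \<beta>_pos] by (simp add: ennreal_le_iff)
    moreover have "utility \<alpha> \<beta> (y p) (g p) \<le> tangent m y g p"
      using assms(1) nn elim(2) by (intro utility_le_tangent(1)) auto
    ultimately show ?case
      using assms(1) nn elim(2) by (intro utility_le_tangent(2)) auto
  qed
qed

lemma nn_integral_opt:
  assumes "0 \<le> m"
  shows "(\<integral>\<^sup>+ p. ennreal (E p * opt_x m p) \<partial>N) = ennreal (\<alpha> * m / (\<alpha> + \<beta>))"
    and "(\<integral>\<^sup>+ p. ennreal (r * opt_c m p) \<partial>N) = ennreal (\<beta> * m / (\<alpha> + \<beta>))"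
proof -
  have scaled: "(\<integral>\<^sup>+ p. ennreal (k / K * Z p) \<partial>N) = ennreal k" if "0 \<le> k" for k
  proof -
    have "(\<integral>\<^sup>+ p. ennreal (k / K * Z p) \<partial>N) = (\<integral>\<^sup>+ p. ennreal (k / K) * ennreal (Z p) \<partial>N)"
      using that K_pos Z_pos by (intro nn_integral_cong ennreal_mult) (auto simp: less_imp_le)
    also have "\<dots> = ennreal (k / K) * ennreal K"
      by (simp add: nn_integral_cmult nn_integral_Z)
    also have "\<dots> = ennreal k"
      using that K_pos by (simp flip: ennreal_mult)
    finally show ?thesis .
  qed
  have eq: "E p * opt_x m p = \<alpha> * m / (\<alpha> + \<beta>) / K * Z p"
    "r * opt_c m p = \<beta> * m / (\<alpha> + \<beta>) / K * Z p" for p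
    using E_pos[of p] r_pos by (simp_all add: opt_x_def opt_c_def)
  show "(\<integral>\<^sup>+ p. ennreal (E p * opt_x m p) \<partial>N) = ennreal (\<alpha> * m / (\<alpha> + \<beta>))"
    unfolding eq(1) using assms \<alpha>_pos \<beta>_pos by (intro scaled) simp
  show "(\<integral>\<^sup>+ p. ennreal (r * opt_c m p) \<partial>N) = ennreal (\<beta> * m / (\<alpha> + \<beta>))"
    unfolding eq(2) using assms \<alpha>_pos \<beta>_pos by (intro scaled) simp
qed

lemma expenditure_split:
  assumes "admissible y" "admissible g"
  shows "expenditure y g = (\<integral>\<^sup>+ p. ennreal (E p * y p) \<partial>N) + (\<integral>\<^sup>+ p. ennreal (r * g p) \<partial>N)"
proof -
  have [measurable]: "y \<in> borel_measurable N" "g \<in> borel_measurable N"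
    and nn: "\<And>p. p \<in> space N \<Longrightarrow> 0 \<le> y p" "\<And>p. p \<in> space N \<Longrightarrow> 0 \<le> g p"
    using assms by (auto simp: admissible_def)
  show ?thesis
    unfolding expenditure_def using nn E_pos r_pos
    by (subst nn_integral_add[symmetric]) (auto intro!: nn_integral_cong simp: ennreal_plus less_imp_le)
qed

lemma expenditure_sum:
  assumes "\<And>i. i < n \<Longrightarrow> admissible (x i) \<and> admissible (c i)"
  shows "(\<Sum>i<n. expenditure (x i) (c i)) = expenditure (\<lambda>p. \<Sum>i<n. x i p) (\<lambda>p. \<Sum>i<n. c i p)"
proof -
  have [measurable]: "x i \<in> borel_measurable N" "c i \<in> borel_measurable N" if "i < n" for i
    using assms[OF that] by (auto simp: admissible_def)
  have "(\<Sum>i<n. expenditure (x i) (c i)) = (\<integral>\<^sup>+ p. (\<Sum>i<n. ennreal (E p * x i p + r * c i p)) \<partial>N)"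
    unfolding expenditure_def by (intro nn_integral_sum[symmetric]) auto
  also have "\<dots> = (\<integral>\<^sup>+ p. ennreal (\<Sum>i<n. E p * x i p + r * c i p) \<partial>N)"
    using assms E_pos r_pos
    by (intro nn_integral_cong sum_ennreal) (auto simp: admissible_def less_imp_le)
  finally show ?thesis
    by (simp add: expenditure_def sum.distrib sum_distrib_left)
qed

lemma admissible_sum:
  "(\<And>i. i \<in> I \<Longrightarrow> admissible (y i)) \<Longrightarrow> admissible (\<lambda>p. \<Sum>i\<in>I. y i p)"
  by (auto simp: admissible_def intro!: sum_nonneg borel_measurable_sum)

lemma expenditure_opt:
  assumes "0 < m"
  shows "expenditure (opt_x m) (opt_c m) = ennreal m"
proof -
  have "expenditure (opt_x m) (opt_c m) = ennreal (\<alpha> * m / (\<alpha> + \<beta>) + \<beta> * m / (\<alpha> + \<beta>))"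
    using assms \<alpha>_pos \<beta>_pos
    by (simp add: expenditure_split admissible_opt nn_integral_opt ennreal_plus)
  also have "\<alpha> * m / (\<alpha> + \<beta>) + \<beta> * m / (\<alpha> + \<beta>) = (\<alpha> + \<beta>) * m / (\<alpha> + \<beta>)"
    by (simp add: add_divide_distrib distrib_right)
  finally show ?thesis
    using \<alpha>_pos \<beta>_pos by simp
qed

lemma planner_bound:
  assumes "1 \<le> n" and x: "\<And>i. i < n \<Longrightarrow> admissible (x i)" and g: "admissible g"
  shows "(\<Sum>i<n. ennreal (1 / real n) * J (x i) g)
    \<le> ennreal (real n powr - \<alpha>) * J (\<lambda>p. \<Sum>i<n. x i p) g"
proof -
  have [measurable]: "g \<in> borel_measurable N" "\<And>i. i < n \<Longrightarrow> x i \<in> borel_measurable N"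
    using x g by (auto simp: admissible_def)
  have X: "admissible (\<lambda>p. \<Sum>i<n. x i p)"
    using x by (intro admissible_sum) auto
  then have [measurable]: "(\<lambda>p. \<Sum>i<n. x i p) \<in> borel_measurable N"
    by (simp add: admissible_def)
  have "(\<Sum>i<n. ennreal (1 / real n) * J (x i) g)
      = (\<integral>\<^sup>+ p. (\<Sum>i<n. ennreal (1 / real n) * ennreal (utility \<alpha> \<beta> (x i p) (g p))) \<partial>N)"
    unfolding J_def by (subst nn_integral_sum) (auto simp: nn_integral_cmult)
  also have "\<dots> \<le> (\<integral>\<^sup>+ p. ennreal (real n powr - \<alpha>)
      * ennreal (utility \<alpha> \<beta> (\<Sum>i<n. x i p) (g p)) \<partial>N)"
  proof (rule nn_integral_mono)
    fix p assume p: "p \<in> space N"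
    have nn: "0 \<le> utility \<alpha> \<beta> a b" for a b
      using utility_nonneg[OF \<alpha>_pos \<beta>_pos] .
    have "(\<Sum>i<n. ennreal (1 / real n) * ennreal (utility \<alpha> \<beta> (x i p) (g p)))
        = ennreal (1 / real n * (\<Sum>i<n. utility \<alpha> \<beta> (x i p) (g p)))"
      by (simp only: nn sum_ennreal flip: sum_distrib_left) (simp add: nn sum_nonneg flip: ennreal_mult)
    also have "\<dots> \<le> ennreal (1 / real n * (real n * utility \<alpha> \<beta> ((\<Sum>i<n. x i p) / real n) (g p)))"
      using x g p \<alpha>_pos \<beta>_pos exponents
      by (intro ennreal_leI mult_left_mono utility_jensen) (auto simp: admissible_def)
    also have "1 / real n * (real n * utility \<alpha> \<beta> ((\<Sum>i<n. x i p) / real n) (g p))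
        = real n powr - \<alpha> * utility \<alpha> \<beta> (\<Sum>i<n. x i p) (g p)"
      using assms(1) X p by (subst utility_divide) (auto simp: admissible_def)
    finally show "(\<Sum>i<n. ennreal (1 / real n) * ennreal (utility \<alpha> \<beta> (x i p) (g p)))
        \<le> ennreal (real n powr - \<alpha>) * ennreal (utility \<alpha> \<beta> (\<Sum>i<n. x i p) (g p))"
      by (simp add: ennreal_mult nn)
  qed
  also have "\<dots> = ennreal (real n powr - \<alpha>) * J (\<lambda>p. \<Sum>i<n. x i p) g"
    unfolding J_def by (simp add: nn_integral_cmult)
  finally show ?thesis .
qed

lemma planner_equal_shares:
  assumes "1 \<le> n" and "admissible y" "admissible g"
  shows "(\<Sum>i<n. ennreal (1 / real n) * J (\<lambda>p. y p / real n) g) = ennreal (real n powr - \<alpha>) * J y g"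
proof -
  have [measurable]: "y \<in> borel_measurable N" "g \<in> borel_measurable N"
    using assms by (auto simp: admissible_def)
  have "(\<Sum>i<n. ennreal (1 / real n) * J (\<lambda>p. y p / real n) g)
      = (ennreal (real n) * ennreal (1 / real n)) * J (\<lambda>p. y p / real n) g"
    by (simp add: mult.assoc ennreal_of_nat_eq_real_of_nat)
  also have "ennreal (real n) * ennreal (1 / real n) = 1"
    using assms(1) by (simp flip: ennreal_mult)
  also have "1 * J (\<lambda>p. y p / real n) g
      = (\<integral>\<^sup>+ p. ennreal (real n powr - \<alpha>) * ennreal (utility \<alpha> \<beta> (y p) (g p)) \<partial>N)"
    unfolding J_def mult_1 using assms utility_nonneg[OF \<alpha>_pos \<beta>_pos]
    by (intro nn_integral_cong) (auto simp: admissible_def utility_divide simp flip: ennreal_mult)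
  also have "\<dots> = ennreal (real n powr - \<alpha>) * J y g"
    unfolding J_def by (simp add: nn_integral_cmult)
  finally show ?thesis .
qed

text \<open>The budget under which the symmetric equilibrium is optimal for a single decision maker who
  pays the whole aggregate contribution.\<close>

definition nash_budget :: "nat \<Rightarrow> real \<Rightarrow> real" where
  "nash_budget n w = real n * w * (\<alpha> + \<beta>) / (real n * \<alpha> + \<beta>)"

lemma nash_budget_pos: "1 \<le> n \<Longrightarrow> 0 < w \<Longrightarrow> 0 < nash_budget n w"
  using \<alpha>_pos \<beta>_pos by (simp add: nash_budget_def add_pos_pos)

lemma nash_budget_split:
  assumes "1 \<le> n"
  shows "\<alpha> * nash_budget n w / (\<alpha> + \<beta>) + \<beta> * nash_budget n w / (\<alpha> + \<beta>) / real n = w"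
proof -
  have "0 < real n * \<alpha> + \<beta>"
    using assms \<alpha>_pos \<beta>_pos by (simp add: add_pos_pos)
  then show ?thesis
    using assms \<alpha>_pos \<beta>_pos by (simp add: nash_budget_def divide_simps) (simp add: algebra_simps)
qed

lemma nn_integral_divide_real:
  assumes "0 < k" "f \<in> borel_measurable N" "(\<integral>\<^sup>+ p. ennreal (f p) \<partial>N) = ennreal a" "0 \<le> a"
  shows "(\<integral>\<^sup>+ p. ennreal (f p / k) \<partial>N) = ennreal (a / k)"
proof -
  have "(\<integral>\<^sup>+ p. ennreal (f p / k) \<partial>N) = (\<integral>\<^sup>+ p. ennreal (1 / k) * ennreal (f p) \<partial>N)"
    using assms(1) by (intro nn_integral_cong) (simp flip: ennreal_mult')
  also have "\<dots> = ennreal (1 / k) * ennreal a"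
    using assms by (simp add: nn_integral_cmult)
  also have "\<dots> = ennreal (a / k)"
    using assms by (simp flip: ennreal_mult)
  finally show ?thesis .
qed

lemma nash_feasible:
  assumes "1 \<le> n" "0 < w"
  shows "expenditure (opt_x (nash_budget n w)) (\<lambda>p. opt_c (nash_budget n w) p / real n) = ennreal w"
proof -
  let ?m = "nash_budget n w"
  have m: "0 < ?m" using assms by (rule nash_budget_pos)
  have "admissible (\<lambda>p. opt_c ?m p / real n)"
    using admissible_opt(2)[OF m] by (auto simp: admissible_def)
  then have "expenditure (opt_x ?m) (\<lambda>p. opt_c ?m p / real n)
      = ennreal (\<alpha> * ?m / (\<alpha> + \<beta>)) + (\<integral>\<^sup>+ p. ennreal (r * opt_c ?m p / real n) \<partial>N)"
    using admissible_opt[OF m] m by (simp add: expenditure_split nn_integral_opt)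
  also have "(\<integral>\<^sup>+ p. ennreal (r * opt_c ?m p / real n) \<partial>N) = ennreal (\<beta> * ?m / (\<alpha> + \<beta>) / real n)"
    using assms(1) m \<alpha>_pos \<beta>_pos by (intro nn_integral_divide_real nn_integral_opt) auto
  also have "ennreal (\<alpha> * ?m / (\<alpha> + \<beta>)) + ennreal (\<beta> * ?m / (\<alpha> + \<beta>) / real n)
      = ennreal (\<alpha> * ?m / (\<alpha> + \<beta>) + \<beta> * ?m / (\<alpha> + \<beta>) / real n)"
    using m \<alpha>_pos \<beta>_pos by (intro ennreal_plus[symmetric]) auto
  finally show ?thesis
    using assms(1) by (simp only: nash_budget_split)
qed

lemma nash_best_response:
  assumes "1 \<le> n" "0 < w" and y: "admissible y" and d: "admissible d"
    and cost: "expenditure y d \<le> ennreal w"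
  shows "J y (\<lambda>p. d p + (real n - 1) * (opt_c (nash_budget n w) p / real n))
    \<le> J (opt_x (nash_budget n w)) (opt_c (nash_budget n w))"
proof (rule J_le_opt)
  let ?m = "nash_budget n w"
  let ?D = "\<lambda>p. (real n - 1) * (opt_c ?m p / real n)"
  show m: "0 < ?m" using assms(1,2) by (rule nash_budget_pos)
  have [measurable]: "y \<in> borel_measurable N" "d \<in> borel_measurable N"
    and nn: "\<And>p. p \<in> space N \<Longrightarrow> 0 \<le> y p" "\<And>p. p \<in> space N \<Longrightarrow> 0 \<le> d p"
    using y d by (auto simp: admissible_def)
  show "admissible y" by fact
  show g: "admissible (\<lambda>p. d p + ?D p)"
    using d admissible_opt(2)[OF m] assms(1) by (auto simp: admissible_def)
  have D: "(\<integral>\<^sup>+ p. ennreal (r * ?D p) \<partial>N) = ennreal ((real n - 1) * (\<beta> * ?m / (\<alpha> + \<beta>) / real n))"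
  proof -
    have "(\<integral>\<^sup>+ p. ennreal (r * ?D p) \<partial>N)
        = (\<integral>\<^sup>+ p. ennreal (real n - 1) * ennreal (r * opt_c ?m p / real n) \<partial>N)"
      using assms(1) r_pos opt_pos(2)[OF m]
      by (intro nn_integral_cong) (simp add: mult.left_commute flip: ennreal_mult')
    also have "\<dots> = ennreal (real n - 1) * ennreal (\<beta> * ?m / (\<alpha> + \<beta>) / real n)"
      using assms(1) m \<alpha>_pos \<beta>_pos
      by (simp add: nn_integral_cmult nn_integral_divide_real[OF _ _ nn_integral_opt(2)])
    also have "\<dots> = ennreal ((real n - 1) * (\<beta> * ?m / (\<alpha> + \<beta>) / real n))"
      using assms(1) m \<alpha>_pos \<beta>_pos by (intro ennreal_mult[symmetric]) auto
    finally show ?thesis .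
  qed
  have "expenditure y (\<lambda>p. d p + ?D p) = expenditure y d + (\<integral>\<^sup>+ p. ennreal (r * ?D p) \<partial>N)"
  proof -
    have "expenditure y (\<lambda>p. d p + ?D p)
        = (\<integral>\<^sup>+ p. ennreal (E p * y p + r * d p) + ennreal (r * ?D p) \<partial>N)"
      unfolding expenditure_def
      using nn E_pos r_pos assms(1) opt_pos(2)[OF m]
      by (intro nn_integral_cong) (simp add: less_imp_le distrib_left add.assoc flip: ennreal_plus)
    then show ?thesis
      by (simp add: nn_integral_add expenditure_def)
  qed
  also have "\<dots> \<le> ennreal w + ennreal ((real n - 1) * (\<beta> * ?m / (\<alpha> + \<beta>) / real n))"
    unfolding D using cost by (rule add_right_mono)
  also have "\<dots> = ennreal (w + (real n - 1) * (\<beta> * ?m / (\<alpha> + \<beta>) / real n))"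
    using assms(1,2) m \<alpha>_pos \<beta>_pos by (intro ennreal_plus[symmetric]) auto
  also have "w + (real n - 1) * (\<beta> * ?m / (\<alpha> + \<beta>) / real n) = ?m"
  proof -
    have "w + (real n - 1) * (\<beta> * ?m / (\<alpha> + \<beta>) / real n)
        = \<alpha> * ?m / (\<alpha> + \<beta>) + real n * (\<beta> * ?m / (\<alpha> + \<beta>) / real n)"
    proof -
      define A q where "A = \<alpha> * ?m / (\<alpha> + \<beta>)" and "q = \<beta> * ?m / (\<alpha> + \<beta>) / real n"
      have "w = A + q"
        using nash_budget_split[OF assms(1), of w] by (simp add: A_def q_def)
      then have "w + (real n - 1) * q = A + real n * q"
        by (simp add: algebra_simps)
      then show ?thesis
        by (simp only: A_def q_def)
    qed
    also have "real n * (\<beta> * ?m / (\<alpha> + \<beta>) / real n) = \<beta> * ?m / (\<alpha> + \<beta>)"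
      using assms(1) by (intro nonzero_mult_div_cancel_left[of "real n", folded times_divide_eq_right]) auto
    also have "\<alpha> * ?m / (\<alpha> + \<beta>) + \<beta> * ?m / (\<alpha> + \<beta>) = (\<alpha> + \<beta>) * ?m / (\<alpha> + \<beta>)"
      by (simp add: add_divide_distrib distrib_right)
    also have "\<dots> = ?m"
      using \<alpha>_pos \<beta>_pos by simp
    finally show ?thesis .
  qed
  finally show "expenditure y (\<lambda>p. d p + ?D p) \<le> ennreal ?m" .
qed

text \<open>If an agent moves her own consumption by the fraction \<open>1 / n\<close> towards \<open>y\<close> and replaces her
  contribution \<open>c\<close> by \<open>g / n\<close>, the aggregate contribution moves by the fraction \<open>1 / n\<close> from
  \<open>n c\<close> towards \<open>g\<close>. By concavity of the utility, a best response to \<open>(n - 1) c\<close> is therefore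
  optimal for the decision maker who pays the whole aggregate.\<close>

lemma nash_unique:
  assumes "1 \<le> n" "0 < w" and x: "admissible x" and c: "admissible c"
    and cost: "expenditure x c \<le> ennreal w"
    and best: "\<And>m y d. 0 < m \<Longrightarrow> y = (\<lambda>p. (1 - 1 / real n) * x p + 1 / real n * opt_x m p) \<Longrightarrow>
      d = (\<lambda>p. 1 / real n * opt_c m p) \<Longrightarrow> expenditure y d \<le> ennreal w \<Longrightarrow>
      J y (\<lambda>p. d p + (real n - 1) * c p) \<le> J x (\<lambda>p. real n * c p)"
  shows "AE p in N. real n * c p = opt_c (nash_budget n w) p"
proof -
  have [measurable]: "x \<in> borel_measurable N" "c \<in> borel_measurable N"
    and nn: "\<And>p. p \<in> space N \<Longrightarrow> 0 \<le> x p" "\<And>p. p \<in> space N \<Longrightarrow> 0 \<le> c p"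
    using x c by (auto simp: admissible_def)
  have n: "1 \<le> real n" using assms(1) by simp
  have sum_le: "(\<integral>\<^sup>+ p. ennreal (E p * x p) \<partial>N) + (\<integral>\<^sup>+ p. ennreal (r * c p) \<partial>N) \<le> ennreal w"
    using cost x c by (simp add: expenditure_split)
  obtain a where a: "0 \<le> a" "(\<integral>\<^sup>+ p. ennreal (E p * x p) \<partial>N) = ennreal a"
    using sum_le by (cases "\<integral>\<^sup>+ p. ennreal (E p * x p) \<partial>N") (auto simp: top_unique)
  obtain b where b: "0 \<le> b" "(\<integral>\<^sup>+ p. ennreal (r * c p) \<partial>N) = ennreal b"
    using sum_le by (cases "\<integral>\<^sup>+ p. ennreal (r * c p) \<partial>N") (auto simp: top_unique)
  have ab: "a + b \<le> w"
    using sum_le a b assms(2) by (simp flip: ennreal_plus)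
  define m where "m = real n * w - (real n - 1) * a"
  have "(real n - 1) * a \<le> (real n - 1) * w"
    using ab b n by (intro mult_left_mono) auto
  then have m: "0 < m"
    using assms(2) by (simp add: m_def algebra_simps)
  have ncad: "admissible (\<lambda>p. real n * c p)"
    using c by (auto simp: admissible_def)
  have nc: "(\<integral>\<^sup>+ p. ennreal (r * (real n * c p)) \<partial>N) = ennreal (real n * b)"
  proof -
    have "(\<integral>\<^sup>+ p. ennreal (r * (real n * c p)) \<partial>N) = (\<integral>\<^sup>+ p. ennreal (real n) * ennreal (r * c p) \<partial>N)"
      by (intro nn_integral_cong) (simp add: mult.left_commute flip: ennreal_mult')
    then show ?thesis
      using b by (simp add: nn_integral_cmult ennreal_mult)
  qed
  have feasible: "expenditure x (\<lambda>p. real n * c p) \<le> ennreal m"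
  proof -
    have "expenditure x (\<lambda>p. real n * c p) = ennreal (a + real n * b)"
      using x ncad a b nc by (simp add: expenditure_split ennreal_plus)
    moreover have "real n * b \<le> real n * (w - a)"
      using ab n by (intro mult_left_mono) auto
    ultimately show ?thesis
      by (simp add: m_def algebra_simps ennreal_leI)
  qed
  define \<epsilon> where "\<epsilon> = 1 / real n"
  have \<epsilon>: "0 < \<epsilon>" "\<epsilon> \<le> 1" using n by (auto simp: \<epsilon>_def)
  let ?y = "\<lambda>p. (1 - \<epsilon>) * x p + \<epsilon> * opt_x m p" and ?d = "\<lambda>p. \<epsilon> * opt_c m p"
  have yd: "admissible ?y" "admissible ?d"
    using x admissible_opt[OF m] \<epsilon> by (auto simp: admissible_def)
  have "expenditure ?y ?d = ennreal w"
  proof -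
    have "(\<integral>\<^sup>+ p. ennreal (E p * ?y p) \<partial>N)
        = (\<integral>\<^sup>+ p. ennreal (1 - \<epsilon>) * ennreal (E p * x p) + ennreal \<epsilon> * ennreal (E p * opt_x m p) \<partial>N)"
      using nn \<epsilon> E_pos opt_pos(1)[OF m]
      by (intro nn_integral_cong)
        (simp add: distrib_left mult.left_commute less_imp_le flip: ennreal_mult ennreal_plus)
    also have "\<dots> = ennreal (1 - \<epsilon>) * ennreal a + ennreal \<epsilon> * ennreal (\<alpha> * m / (\<alpha> + \<beta>))"
      using m a by (simp add: nn_integral_add nn_integral_cmult nn_integral_opt)
    also have "ennreal (1 - \<epsilon>) * ennreal a = ennreal ((1 - \<epsilon>) * a)"
      using \<epsilon> a by (intro ennreal_mult[symmetric]) auto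
    also have "ennreal \<epsilon> * ennreal (\<alpha> * m / (\<alpha> + \<beta>)) = ennreal (\<epsilon> * (\<alpha> * m / (\<alpha> + \<beta>)))"
      using \<epsilon> m \<alpha>_pos \<beta>_pos by (intro ennreal_mult[symmetric]) auto
    also have "ennreal ((1 - \<epsilon>) * a) + ennreal (\<epsilon> * (\<alpha> * m / (\<alpha> + \<beta>)))
        = ennreal ((1 - \<epsilon>) * a + \<epsilon> * (\<alpha> * m / (\<alpha> + \<beta>)))"
      using \<epsilon> a m \<alpha>_pos \<beta>_pos by (intro ennreal_plus[symmetric]) auto
    finally have 1: "(\<integral>\<^sup>+ p. ennreal (E p * ?y p) \<partial>N) = \<dots>" .
    have "(\<integral>\<^sup>+ p. ennreal (r * ?d p) \<partial>N) = (\<integral>\<^sup>+ p. ennreal \<epsilon> * ennreal (r * opt_c m p) \<partial>N)"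
      using \<epsilon> by (intro nn_integral_cong) (simp add: mult.left_commute flip: ennreal_mult')
    also have "\<dots> = ennreal \<epsilon> * ennreal (\<beta> * m / (\<alpha> + \<beta>))"
      using m by (simp add: nn_integral_cmult nn_integral_opt)
    also have "\<dots> = ennreal (\<epsilon> * (\<beta> * m / (\<alpha> + \<beta>)))"
      using \<epsilon> m \<alpha>_pos \<beta>_pos by (intro ennreal_mult[symmetric]) auto
    finally have 2: "(\<integral>\<^sup>+ p. ennreal (r * ?d p) \<partial>N) = \<dots>" .
    have "expenditure ?y ?d
        = ennreal ((1 - \<epsilon>) * a + \<epsilon> * (\<alpha> * m / (\<alpha> + \<beta>)) + \<epsilon> * (\<beta> * m / (\<alpha> + \<beta>)))"
      unfolding expenditure_split[OF yd] 1 2 using \<epsilon> a m \<alpha>_pos \<beta>_pos by (simp add: ennreal_plus)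
    also have "(1 - \<epsilon>) * a + \<epsilon> * (\<alpha> * m / (\<alpha> + \<beta>)) + \<epsilon> * (\<beta> * m / (\<alpha> + \<beta>))
        = (1 - \<epsilon>) * a + \<epsilon> * ((\<alpha> + \<beta>) * m / (\<alpha> + \<beta>))"
      by (simp add: add_divide_distrib distrib_left distrib_right)
    also have "(\<alpha> + \<beta>) * m / (\<alpha> + \<beta>) = m"
      using \<alpha>_pos \<beta>_pos by simp
    also have "(1 - \<epsilon>) * a + \<epsilon> * m = w"
      using n by (simp add: m_def \<epsilon>_def field_simps)
    finally show ?thesis .
  qed
  then have dev: "J ?y (\<lambda>p. ?d p + (real n - 1) * c p) \<le> J x (\<lambda>p. real n * c p)"
    using best[OF m, of ?y ?d] by (simp add: \<epsilon>_def)
  have split: "?d p + (real n - 1) * c p = (1 - \<epsilon>) * (real n * c p) + \<epsilon> * opt_c m p" for p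
    using n by (simp add: \<epsilon>_def field_simps)
  have "ennreal (1 - \<epsilon>) * J x (\<lambda>p. real n * c p) + ennreal \<epsilon> * J (opt_x m) (opt_c m)
      = (\<integral>\<^sup>+ p. ennreal (1 - \<epsilon>) * ennreal (utility \<alpha> \<beta> (x p) (real n * c p))
        + ennreal \<epsilon> * ennreal (utility \<alpha> \<beta> (opt_x m p) (opt_c m p)) \<partial>N)"
    unfolding J_def by (simp add: nn_integral_add nn_integral_cmult)
  also have "\<dots> \<le> J ?y (\<lambda>p. ?d p + (real n - 1) * c p)"
    unfolding J_def split
  proof (rule nn_integral_mono)
    fix p assume p: "p \<in> space N"
    have "(1 - \<epsilon>) * utility \<alpha> \<beta> (x p) (real n * c p) + \<epsilon> * utility \<alpha> \<beta> (opt_x m p) (opt_c m p)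
        \<le> utility \<alpha> \<beta> (?y p) ((1 - \<epsilon>) * (real n * c p) + \<epsilon> * opt_c m p)"
      using \<alpha>_pos \<beta>_pos exponents \<epsilon> nn[OF p] opt_pos[OF m] by (intro utility_concave) auto
    then show "ennreal (1 - \<epsilon>) * ennreal (utility \<alpha> \<beta> (x p) (real n * c p))
        + ennreal \<epsilon> * ennreal (utility \<alpha> \<beta> (opt_x m p) (opt_c m p))
        \<le> ennreal (utility \<alpha> \<beta> (?y p) ((1 - \<epsilon>) * (real n * c p) + \<epsilon> * opt_c m p))"
      using \<epsilon> utility_nonneg[OF \<alpha>_pos \<beta>_pos] by (simp add: ennreal_leI flip: ennreal_mult ennreal_plus)
  qed
  also note dev
  finally have conc: "ennreal (1 - \<epsilon>) * J x (\<lambda>p. real n * c p) + ennreal \<epsilon> * J (opt_x m) (opt_c m)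
      \<le> J x (\<lambda>p. real n * c p)" .
  have optimal: "J (opt_x m) (opt_c m) \<le> J x (\<lambda>p. real n * c p)"
  proof -
    have "J x (\<lambda>p. real n * c p) \<le> ennreal (opt_coeff m * K)"
      using J_le_opt[OF m x ncad feasible] m by (simp add: J_opt)
    then obtain j where j: "0 \<le> j" "J x (\<lambda>p. real n * c p) = ennreal j"
      by (cases "J x (\<lambda>p. real n * c p)") (auto simp: top_unique)
    have k: "0 \<le> opt_coeff m * K"
      using opt_coeff_pos[OF m] K_pos by simp
    have "(1 - \<epsilon>) * j + \<epsilon> * (opt_coeff m * K) \<le> j"
      using conc j \<epsilon> k m by (simp add: J_opt flip: ennreal_mult ennreal_plus)
    then have "\<epsilon> * (opt_coeff m * K) \<le> \<epsilon> * j"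
      by (simp add: algebra_simps)
    then show ?thesis
      using \<epsilon> j m by (simp add: J_opt ennreal_leI)
  qed
  have AE: "AE p in N. x p = opt_x m p \<and> real n * c p = opt_c m p"
    using opt_unique[OF m x ncad feasible optimal] .
  have "ennreal a = (\<integral>\<^sup>+ p. ennreal (E p * opt_x m p) \<partial>N)"
    unfolding a(2)[symmetric] using AE by (intro nn_integral_cong_AE) auto
  then have "a = \<alpha> * m / (\<alpha> + \<beta>)"
    using m a \<alpha>_pos \<beta>_pos by (simp add: nn_integral_opt)
  then have am: "\<alpha> * m = a * (\<alpha> + \<beta>)"
    using \<alpha>_pos \<beta>_pos by simp
  have "m * (real n * \<alpha> + \<beta>) = m * (\<alpha> + \<beta>) + (real n - 1) * (\<alpha> * m)"
    by (simp add: algebra_simps)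
  also have "\<dots> = (m + (real n - 1) * a) * (\<alpha> + \<beta>)"
    unfolding am by (simp add: algebra_simps)
  also have "m + (real n - 1) * a = real n * w"
    by (simp add: m_def)
  finally have "m * (real n * \<alpha> + \<beta>) = real n * w * (\<alpha> + \<beta>)" .
  moreover have "0 < real n * \<alpha> + \<beta>"
    using n \<alpha>_pos \<beta>_pos by (simp add: add_pos_pos)
  ultimately have "m = nash_budget n w"
    by (simp add: nash_budget_def field_simps)
  with AE show ?thesis by auto
qed

end

section \<open>Optional processes and Brownian motion\<close>

lemma right_continuous_jointly_measurable:
  fixes X :: "real \<Rightarrow> 'a \<Rightarrow> real"
  assumes meas: "\<And>t. 0 \<le> t \<Longrightarrow> X t \<in> borel_measurable M"
    and rc: "\<And>\<omega> t. \<omega> \<in> space M \<Longrightarrow> 0 \<le> t \<Longrightarrow> ((\<lambda>s. X s \<omega>) \<longlongrightarrow> X t \<omega>) (at_right t)"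
  shows "(\<lambda>p. X (snd p) (fst p)) \<in> borel_measurable (M \<Otimes>\<^sub>M restrict_space lborel {0..})"
proof (rule borel_measurable_LIMSEQ_real)
  let ?P = "M \<Otimes>\<^sub>M restrict_space lborel {0::real..}"
  define S :: "nat \<Rightarrow> nat \<Rightarrow> real" where "S k i = (real i + 1) / real (Suc k)" for k i
  define I :: "nat \<Rightarrow> real \<Rightarrow> nat" where "I k t = nat \<lfloor>t * real (Suc k)\<rfloor>" for k t
  fix p assume "p \<in> space ?P"
  then have \<omega>: "fst p \<in> space M" and t: "0 \<le> snd p"
    by (auto simp: space_pair_measure)
  have bounds: "snd p < S k (I k (snd p))" "S k (I k (snd p)) \<le> snd p + 1 / real (Suc k)" for k
  proof -
    have "real (I k (snd p)) = of_int \<lfloor>snd p * real (Suc k)\<rfloor>"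
      using t by (simp add: I_def)
    then have "snd p * real (Suc k) < real (I k (snd p)) + 1" "real (I k (snd p)) \<le> snd p * real (Suc k)"
      by linarith+
    then show "snd p < S k (I k (snd p))" "S k (I k (snd p)) \<le> snd p + 1 / real (Suc k)"
      unfolding S_def by (simp_all add: field_simps del: of_nat_Suc)
  qed
  have "(\<lambda>k. S k (I k (snd p))) \<longlonglongrightarrow> snd p"
  proof (rule tendsto_sandwich[OF _ _ tendsto_const])
    show "(\<lambda>k. snd p + 1 / real (Suc k)) \<longlonglongrightarrow> snd p"
      using tendsto_add[OF tendsto_const[of "snd p"] LIMSEQ_inverse_real_of_nat]
      by (simp add: inverse_eq_divide)
  qed (use bounds in \<open>auto intro!: always_eventually less_imp_le\<close>)
  then have "filterlim (\<lambda>k. S k (I k (snd p))) (at_right (snd p)) sequentially"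
    using bounds(1) less_imp_neq[OF bounds(1), symmetric]
    by (simp add: filterlim_at eventually_sequentially)
  then show "(\<lambda>k. X (S k (I k (snd p))) (fst p)) \<longlonglongrightarrow> X (snd p) (fst p)"
    by (rule filterlim_compose[OF rc[OF \<omega> t]])
next
  fix k :: nat
  let ?P = "M \<Otimes>\<^sub>M restrict_space lborel {0::real..}"
  have [measurable]: "(\<lambda>p. snd p) \<in> borel_measurable ?P"
    using measurable_snd by (rule measurable_compose) (auto intro: measurable_restrict_space1)
  have "(\<lambda>p. X ((real i + 1) / real (Suc k)) (fst p)) \<in> borel_measurable ?P" for i :: nat
    using measurable_fst by (rule measurable_compose) (auto intro!: meas)
  then show "(\<lambda>p. X ((real (nat \<lfloor>snd p * real (Suc k)\<rfloor>) + 1) / real (Suc k)) (fst p)) \<in> borel_measurable ?P"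
    by (rule measurable_compose_countable) measurable
qed

lemma (in usual_filtered_prob_space) adapted_measurable:
  "adapted F X \<Longrightarrow> 0 \<le> t \<Longrightarrow> X t \<in> borel_measurable M"
  using measurable_from_subalg[OF subalgebra_F] by (auto simp: adapted_def)

lemma (in usual_filtered_prob_space) optional_jointly_measurable:
  assumes "optional M F X"
  shows "(\<lambda>p. X (snd p) (fst p)) \<in> borel_measurable (M \<Otimes>\<^sub>M restrict_space lborel {0..})"
proof -
  let ?P = "M \<Otimes>\<^sub>M restrict_space lborel {0::real..}"
  let ?G = "{{p \<in> space M \<times> {0..}. X (snd p) (fst p) \<in> B} | X B.
        adapted F X \<and> (\<forall>\<omega>\<in>space M. cadlag (\<lambda>t. X t \<omega>)) \<and> B \<in> sets (borel :: real measure)}"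
  have space_P: "space ?P = space M \<times> {0..}"
    by (simp add: space_pair_measure)
  have "?G \<subseteq> sets ?P"
  proof clarify
    fix Y B assume Y: "adapted F Y" "\<forall>\<omega>\<in>space M. cadlag (\<lambda>t. Y t \<omega>)" and B: "B \<in> sets (borel :: real measure)"
    have "(\<lambda>p. Y (snd p) (fst p)) \<in> borel_measurable ?P"
      using Y by (intro right_continuous_jointly_measurable) (auto simp: cadlag_def adapted_measurable)
    from measurable_sets[OF this B]
    show "{p \<in> space M \<times> {0..}. Y (snd p) (fst p) \<in> B} \<in> sets ?P"
      by (simp add: space_P vimage_def Int_def conj_commute)
  qed
  then have "sigma_sets (space M \<times> {0..}) ?G \<subseteq> sets ?P"
    using sets.sigma_sets_subset[of ?G ?P] by (simp only: space_P)
  moreover have "?G \<subseteq> Pow (space M \<times> {0..})"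
    by auto
  ultimately have "sets (optional_sigma M F) \<subseteq> sets ?P" "space (optional_sigma M F) = space ?P"
    unfolding optional_sigma_def space_P by (simp_all only: sets_measure_of space_measure_of)
  then show ?thesis
    using assms unfolding optional_def measurable_def by auto
qed

lemma optional_continuous_function:
  assumes "adapted F V" and "\<And>\<omega>. \<omega> \<in> space M \<Longrightarrow> continuous_on {0..} (\<lambda>t. V t \<omega>)"
    and h: "continuous_on UNIV (h :: real \<Rightarrow> real)"
  shows "optional M F (\<lambda>t \<omega>. h (V t \<omega>))"
proof -
  have [measurable]: "h \<in> borel_measurable borel"
    using h by (rule borel_measurable_continuous_onI)
  have adapted: "adapted F (\<lambda>t \<omega>. h (V t \<omega>))"
    using assms(1) by (auto simp: adapted_def)
  have cadlag: "cadlag (\<lambda>t. h (V t \<omega>))" if "\<omega> \<in> space M" for \<omega>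
  proof -
    have c: "continuous_on {0..} (\<lambda>t. h (V t \<omega>))"
      using continuous_on_compose2[OF h assms(2)[OF that]] by simp
    have "((\<lambda>s. h (V s \<omega>)) \<longlongrightarrow> h (V t \<omega>)) (at_right t)" if "0 \<le> t" for t
    proof -
      have "((\<lambda>s. h (V s \<omega>)) \<longlongrightarrow> h (V t \<omega>)) (at t within {0..})"
        using c that by (simp add: continuous_on_def)
      then show ?thesis
        by (rule tendsto_within_subset) (use that in auto)
    qed
    moreover have "((\<lambda>s. h (V s \<omega>)) \<longlongrightarrow> h (V t \<omega>)) (at_left t)" if "0 < t" for t
    proof -
      have "isCont (\<lambda>s. h (V s \<omega>)) t"
        using c that by (intro continuous_on_interior[OF c]) auto
      then show ?thesis
        unfolding isCont_def by (rule tendsto_within_subset) auto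
    qed
    ultimately show ?thesis
      unfolding cadlag_def by blast
  qed
  let ?G = "{{p \<in> space M \<times> {0..}. X (snd p) (fst p) \<in> B} | X B.
        adapted F X \<and> (\<forall>\<omega>\<in>space M. cadlag (\<lambda>t. X t \<omega>)) \<and> B \<in> sets (borel :: real measure)}"
  have G: "?G \<subseteq> Pow (space M \<times> {0..})" by auto
  have sp: "space (optional_sigma M F) = space M \<times> {0..}"
    unfolding optional_sigma_def using G by (rule space_measure_of)
  have "(\<lambda>p. h (V (snd p) (fst p))) -` B \<inter> space (optional_sigma M F) \<in> sets (optional_sigma M F)"
    if B: "B \<in> sets borel" for B
  proof -
    have "(\<lambda>p. h (V (snd p) (fst p))) -` B \<inter> space (optional_sigma M F)
        = {p \<in> space M \<times> {0..}. h (V (snd p) (fst p)) \<in> B}"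
      unfolding sp by auto
    also have "\<dots> \<in> ?G"
      by (intro CollectI exI[of _ "\<lambda>t \<omega>. h (V t \<omega>)"] exI[of _ B] conjI refl)
        (use adapted cadlag B in auto)
    also have "?G \<subseteq> sets (optional_sigma M F)"
      unfolding optional_sigma_def using G by (simp only: sets_measure_of) (rule sigma_sets_superset_generator)
    finally show ?thesis .
  qed
  then show ?thesis
    unfolding optional_def by (auto simp: measurable_def)
qed

definition discounted :: "'a measure \<Rightarrow> real \<Rightarrow> ('a \<times> real) measure" where
  "discounted M r = density (M \<Otimes>\<^sub>M restrict_space lborel {0..}) (\<lambda>p. ennreal (exp (- r * snd p)))"

lemma snd_measurable_horizon [measurable]:
  "snd \<in> borel_measurable (M \<Otimes>\<^sub>M restrict_space lborel {0::real..})"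
  using measurable_snd by (rule measurable_compose) (auto intro: measurable_restrict_space1)

lemma measurable_discounted [simp]:
  "borel_measurable (discounted M r) = borel_measurable (M \<Otimes>\<^sub>M restrict_space lborel {0..})"
  unfolding discounted_def by (rule measurable_cong_sets) simp_all

lemma space_discounted [simp]: "space (discounted M r) = space M \<times> {0..}"
  by (simp add: discounted_def space_pair_measure)

lemma sigma_finite_horizon: "sigma_finite_measure (restrict_space lborel {0::real..})"
  by (intro sigma_finite_measure_restrict_space lborel.sigma_finite_measure_axioms) auto

lemma AE_discounted:
  "(AE p in discounted M r. P p) \<longleftrightarrow> (AE p in M \<Otimes>\<^sub>M restrict_space lborel {0..}. P p)"
  unfolding discounted_def by (subst AE_density) auto

lemma nn_integral_discounted:
  assumes [measurable]: "f \<in> borel_measurable (M \<Otimes>\<^sub>M restrict_space lborel {0..})"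
  shows "(\<integral>\<^sup>+ p. f p \<partial>discounted M r)
    = (\<integral>\<^sup>+ \<omega>. (\<integral>\<^sup>+ t\<in>{0..}. ennreal (exp (- r * t)) * f (\<omega>, t) \<partial>lborel) \<partial>M)"
proof -
  interpret L: sigma_finite_measure "restrict_space lborel {0::real..}"
    by (rule sigma_finite_horizon)
  have "(\<integral>\<^sup>+ p. f p \<partial>discounted M r)
      = (\<integral>\<^sup>+ p. ennreal (exp (- r * snd p)) * f p \<partial>(M \<Otimes>\<^sub>M restrict_space lborel {0..}))"
    unfolding discounted_def by (rule nn_integral_density) measurable
  also have "\<dots> = (\<integral>\<^sup>+ \<omega>. (\<integral>\<^sup>+ t. ennreal (exp (- r * t)) * f (\<omega>, t) \<partial>restrict_space lborel {0..}) \<partial>M)"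
    by (subst L.nn_integral_fst[symmetric]) auto
  finally show ?thesis
    by (simp add: nn_integral_restrict_space)
qed

lemma payoff_discounted:
  assumes [measurable]: "(\<lambda>p. x (snd p) (fst p)) \<in> borel_measurable (M \<Otimes>\<^sub>M restrict_space lborel {0..})"
    "(\<lambda>p. c (snd p) (fst p)) \<in> borel_measurable (M \<Otimes>\<^sub>M restrict_space lborel {0..})"
    "(\<lambda>p. d (snd p) (fst p)) \<in> borel_measurable (M \<Otimes>\<^sub>M restrict_space lborel {0..})"
  shows "payoff M r \<alpha> \<beta> x c d = (\<integral>\<^sup>+ p. ennreal (utility \<alpha> \<beta> (x (snd p) (fst p))
    (c (snd p) (fst p) + d (snd p) (fst p))) \<partial>discounted M r)"
  unfolding payoff_def
  by (subst nn_integral_discounted) (auto simp: utility_def simp flip: ennreal_mult')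

lemma cost_discounted:
  assumes x [measurable]: "(\<lambda>p. x (snd p) (fst p)) \<in> borel_measurable (M \<Otimes>\<^sub>M restrict_space lborel {0..})"
    and c [measurable]: "(\<lambda>p. c (snd p) (fst p)) \<in> borel_measurable (M \<Otimes>\<^sub>M restrict_space lborel {0..})"
    and V [measurable]: "(\<lambda>p. V (snd p) (fst p)) \<in> borel_measurable (M \<Otimes>\<^sub>M restrict_space lborel {0..})"
    and nn: "\<And>\<omega> t. \<omega> \<in> space M \<Longrightarrow> 0 \<le> t \<Longrightarrow> 0 \<le> x t \<omega> \<and> 0 \<le> c t \<omega>"
    and \<psi>x: "AE \<omega> in M. \<forall>t\<ge>0. \<psi>x t \<omega> = exp (- r * t + \<sigma> * V t \<omega>)" and "0 < r"
  shows "cost M r \<psi>x (\<lambda>t \<omega>. exp (- r * t)) x c = (\<integral>\<^sup>+ p. ennreal (exp (\<sigma> * V (snd p) (fst p)) * x (snd p) (fst p)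
    + r * c (snd p) (fst p)) \<partial>discounted M r)"
proof -
  let ?L = "restrict_space lborel {0::real..}"
  have "AE \<omega> in M. (\<integral>\<^sup>+ t\<in>{0..}. ennreal (\<psi>x t \<omega> * x t \<omega>) \<partial>lborel)
        + ennreal r * (\<integral>\<^sup>+ t\<in>{0..}. ennreal (exp (- r * t) * c t \<omega>) \<partial>lborel)
      = (\<integral>\<^sup>+ t\<in>{0..}. ennreal (exp (- r * t)) * ennreal (exp (\<sigma> * V t \<omega>) * x t \<omega> + r * c t \<omega>) \<partial>lborel)"
    using \<psi>x AE_space
  proof eventually_elim
    case (elim \<omega>)
    have [measurable]: "(\<lambda>t. x t \<omega>) \<in> borel_measurable ?L" "(\<lambda>t. c t \<omega>) \<in> borel_measurable ?L"
      "(\<lambda>t. V t \<omega>) \<in> borel_measurable ?L"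
      using measurable_compose_Pair1[OF elim(2) x] measurable_compose_Pair1[OF elim(2) c]
        measurable_compose_Pair1[OF elim(2) V] by simp_all
    have [measurable]: "(\<lambda>t. t) \<in> borel_measurable ?L"
      by (auto intro: measurable_restrict_space1)
    have price: "\<psi>x t \<omega> = exp (- r * t) * exp (\<sigma> * V t \<omega>)" if "0 \<le> t" for t
      using elim(1) that by (simp flip: exp_add)
    have integrand: "ennreal (exp (- r * t)) * ennreal (exp (\<sigma> * V t \<omega>) * x t \<omega> + r * c t \<omega>)
        = ennreal (exp (- r * t) * (exp (\<sigma> * V t \<omega>) * x t \<omega>)) + ennreal r * ennreal (exp (- r * t) * c t \<omega>)"
      if "0 \<le> t" for t
    proof -
      have pos: "0 \<le> x t \<omega>" "0 \<le> c t \<omega>"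
        using nn[OF elim(2) that] by auto
      have "ennreal (exp (- r * t)) * ennreal (exp (\<sigma> * V t \<omega>) * x t \<omega> + r * c t \<omega>)
          = ennreal (exp (- r * t) * (exp (\<sigma> * V t \<omega>) * x t \<omega> + r * c t \<omega>))"
        using pos assms(6) by (intro ennreal_mult[symmetric]) auto
      also have "exp (- r * t) * (exp (\<sigma> * V t \<omega>) * x t \<omega> + r * c t \<omega>)
          = exp (- r * t) * (exp (\<sigma> * V t \<omega>) * x t \<omega>) + r * (exp (- r * t) * c t \<omega>)"
        by (simp only: distrib_left mult.left_commute)
      also have "ennreal \<dots> = ennreal (exp (- r * t) * (exp (\<sigma> * V t \<omega>) * x t \<omega>))
          + ennreal (r * (exp (- r * t) * c t \<omega>))"
        using pos assms(6) by (intro ennreal_plus) auto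
      also have "ennreal (r * (exp (- r * t) * c t \<omega>)) = ennreal r * ennreal (exp (- r * t) * c t \<omega>)"
        using pos assms(6) by (intro ennreal_mult) auto
      finally show ?thesis .
    qed
    have "(\<integral>\<^sup>+ t\<in>{0..}. ennreal (\<psi>x t \<omega> * x t \<omega>) \<partial>lborel)
        = (\<integral>\<^sup>+ t. ennreal (exp (- r * t) * (exp (\<sigma> * V t \<omega>) * x t \<omega>)) \<partial>?L)"
      unfolding nn_integral_restrict_space[of "{0::real..}" lborel, simplified, symmetric]
      by (intro nn_integral_cong) (auto simp: price mult.assoc split: split_indicator)
    moreover have "ennreal r * (\<integral>\<^sup>+ t\<in>{0..}. ennreal (exp (- r * t) * c t \<omega>) \<partial>lborel)
        = (\<integral>\<^sup>+ t. ennreal r * ennreal (exp (- r * t) * c t \<omega>) \<partial>?L)"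
      unfolding nn_integral_restrict_space[of "{0::real..}" lborel, simplified, symmetric]
      by (rule nn_integral_cmult[symmetric]) measurable
    moreover have "(\<integral>\<^sup>+ t\<in>{0..}. ennreal (exp (- r * t)) * ennreal (exp (\<sigma> * V t \<omega>) * x t \<omega> + r * c t \<omega>) \<partial>lborel)
        = (\<integral>\<^sup>+ t. ennreal (exp (- r * t) * (exp (\<sigma> * V t \<omega>) * x t \<omega>))
          + ennreal r * ennreal (exp (- r * t) * c t \<omega>) \<partial>?L)"
      unfolding nn_integral_restrict_space[of "{0::real..}" lborel, simplified, symmetric]
      by (intro nn_integral_cong) (auto simp: integrand[unfolded minus_mult_left[symmetric]] split: split_indicator)
    ultimately show ?case
      by (simp add: nn_integral_add)
  qed
  then have "cost M r \<psi>x (\<lambda>t \<omega>. exp (- r * t)) x c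
      = (\<integral>\<^sup>+ \<omega>. (\<integral>\<^sup>+ t\<in>{0..}. ennreal (exp (- r * t)) * ennreal (exp (\<sigma> * V t \<omega>) * x t \<omega> + r * c t \<omega>) \<partial>lborel) \<partial>M)"
    unfolding cost_def by (rule nn_integral_cong_AE)
  then show ?thesis
    by (subst nn_integral_discounted) auto
qed

lemma nn_integral_exp_normal:
  assumes "0 < s"
  shows "(\<integral>\<^sup>+ x. ennreal (normal_density 0 s x) * ennreal (exp (k * x)) \<partial>lborel) = ennreal (exp (k\<^sup>2 * s\<^sup>2 / 2))"
proof -
  have "normal_density 0 s x * exp (k * x) = exp (k\<^sup>2 * s\<^sup>2 / 2) * normal_density (k * s\<^sup>2) s x" for x
  proof -
    have "- x\<^sup>2 / (2 * s\<^sup>2) + k * x = k\<^sup>2 * s\<^sup>2 / 2 + - (x - k * s\<^sup>2)\<^sup>2 / (2 * s\<^sup>2)"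
      using assms by (simp add: field_simps power2_eq_square)
    then have "exp (- x\<^sup>2 / (2 * s\<^sup>2)) * exp (k * x)
        = exp (k\<^sup>2 * s\<^sup>2 / 2) * exp (- (x - k * s\<^sup>2)\<^sup>2 / (2 * s\<^sup>2))"
      by (simp only: exp_add[symmetric])
    then show ?thesis
      by (simp add: normal_density_def mult_ac)
  qed
  then have "(\<integral>\<^sup>+ x. ennreal (normal_density 0 s x) * ennreal (exp (k * x)) \<partial>lborel)
      = (\<integral>\<^sup>+ x. ennreal (exp (k\<^sup>2 * s\<^sup>2 / 2)) * ennreal (normal_density (k * s\<^sup>2) s x) \<partial>lborel)"
    by (intro nn_integral_cong) (simp flip: ennreal_mult)
  also have "\<dots> = ennreal (exp (k\<^sup>2 * s\<^sup>2 / 2)) * (\<integral>\<^sup>+ x. ennreal (normal_density (k * s\<^sup>2) s x) \<partial>lborel)"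
    by (rule nn_integral_cmult) measurable
  also have "(\<integral>\<^sup>+ x. ennreal (normal_density (k * s\<^sup>2) s x) \<partial>lborel) = 1"
    using assms by (subst nn_integral_eq_integral) (auto simp: integral_normal_density)
  finally show ?thesis by simp
qed

lemma brownian_motion_exp_moment:
  assumes "usual_filtered_prob_space M F" "brownian_motion M F W" "0 < t"
  shows "(\<integral>\<^sup>+ \<omega>. ennreal (exp (k * W t \<omega>)) \<partial>M) = ennreal (exp (k\<^sup>2 * t / 2))"
proof -
  have D: "distributed M lborel (\<lambda>\<omega>. W t \<omega> - W 0 \<omega>) (normal_density 0 (sqrt t))"
    using assms(2,3) by (auto simp: brownian_motion_def dest: spec[of _ 0])
  have "AE \<omega> in M. W 0 \<omega> = 0"
    using assms(2) by (simp add: brownian_motion_def)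
  then have "(\<integral>\<^sup>+ \<omega>. ennreal (exp (k * W t \<omega>)) \<partial>M) = (\<integral>\<^sup>+ \<omega>. ennreal (exp (k * (W t \<omega> - W 0 \<omega>))) \<partial>M)"
    by (intro nn_integral_cong_AE) auto
  also have "\<dots> = (\<integral>\<^sup>+ x. ennreal (normal_density 0 (sqrt t) x) * ennreal (exp (k * x)) \<partial>lborel)"
    by (rule distributed_nn_integral[OF D, symmetric]) measurable
  also have "\<dots> = ennreal (exp (k\<^sup>2 * t / 2))"
    using assms(3) by (subst nn_integral_exp_normal) auto
  finally show ?thesis .
qed

text \<open>The paths of \<open>W\<close> are only almost surely continuous. The usual conditions allow to
  set \<open>W\<close> to \<open>0\<close> on the exceptional null set without losing adaptedness.\<close>

lemma brownian_motion_continuous_version: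
  assumes "usual_filtered_prob_space M F" "brownian_motion M F W"
  obtains V where "adapted F V" "\<And>\<omega>. \<omega> \<in> space M \<Longrightarrow> continuous_on {0..} (\<lambda>t. V t \<omega>)"
    "AE \<omega> in M. \<forall>t. V t \<omega> = W t \<omega>"
proof -
  interpret usual_filtered_prob_space M F by fact
  have "AE \<omega> in M. continuous_on {0..} (\<lambda>t. W t \<omega>)"
    using assms(2) by (simp add: brownian_motion_def)
  then obtain A where A: "{\<omega> \<in> space M. \<not> continuous_on {0..} (\<lambda>t. W t \<omega>)} \<subseteq> A" "A \<in> null_sets M"
    by (auto simp: eventually_ae_filter)
  define V where "V t \<omega> = (if \<omega> \<in> A then 0 else W t \<omega>)" for t \<omega>
  have "adapted F V"
    unfolding adapted_def
  proof (intro allI impI)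
    fix t :: real assume t: "0 \<le> t"
    have "A \<in> sets (F t)"
      using A(2) null_sets_F mono_F[OF order_refl t] by blast
    moreover have "W t \<in> borel_measurable (F t)"
      using assms(2) t by (simp add: brownian_motion_def adapted_def)
    ultimately show "V t \<in> borel_measurable (F t)"
      unfolding V_def[abs_def] by measurable
  qed
  moreover have "continuous_on {0..} (\<lambda>t. V t \<omega>)" if "\<omega> \<in> space M" for \<omega>
    using A(1) that by (cases "\<omega> \<in> A") (auto simp: V_def)
  moreover have "AE \<omega> in M. \<forall>t. V t \<omega> = W t \<omega>"
    using AE_not_in[OF A(2)] by eventually_elim (simp add: V_def)
  ultimately show thesis by (rule that)
qed

lemma nn_integral_exp_decay:
  assumes "0 < a"
  shows "(\<integral>\<^sup>+ t\<in>{0..}. ennreal (exp (- a * t)) \<partial>lborel) = ennreal (1 / a)"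
proof -
  have "(\<integral>\<^sup>+ t\<in>{0..}. ennreal (exp (- a * t)) \<partial>lborel) = ennreal (0 - - exp (- a * 0) / a)"
  proof (rule nn_integral_FTC_atLeast)
    show "((\<lambda>t. - exp (- a * t) / a) \<longlongrightarrow> 0) at_top"
    proof -
      have "filterlim (\<lambda>t. - a * t) at_bot at_top"
        using assms by (intro filterlim_tendsto_neg_mult_at_bot[OF tendsto_const _ filterlim_ident]) auto
      from filterlim_compose[OF exp_at_bot this] have "((\<lambda>t. - exp (- a * t) / a) \<longlongrightarrow> - 0 / a) at_top"
        by (intro tendsto_intros) (use assms in auto)
      then show ?thesis by simp
    qed
  qed (use assms in \<open>auto intro!: derivative_eq_intros\<close>)
  then show ?thesis by simp
qed

lemma discounted_exp_moment:
  assumes "usual_filtered_prob_space M F" "brownian_motion M F W"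
    and V: "(\<lambda>p. V (snd p) (fst p)) \<in> borel_measurable (M \<Otimes>\<^sub>M restrict_space lborel {0..})"
      "AE \<omega> in M. \<forall>t. V t \<omega> = W t \<omega>"
    and "k\<^sup>2 < 2 * r"
  shows "(\<integral>\<^sup>+ p. ennreal (exp (k * V (snd p) (fst p))) \<partial>discounted M r) = ennreal (1 / (r - k\<^sup>2 / 2))"
proof -
  let ?L = "restrict_space lborel {0::real..}"
  interpret usual_filtered_prob_space M F by fact
  interpret L: sigma_finite_measure ?L
    by (rule sigma_finite_horizon)
  interpret P: pair_sigma_finite M ?L ..
  note [measurable] = V(1)
  have "(\<integral>\<^sup>+ p. ennreal (exp (k * V (snd p) (fst p))) \<partial>discounted M r)
      = (\<integral>\<^sup>+ p. ennreal (exp (- r * snd p)) * ennreal (exp (k * V (snd p) (fst p))) \<partial>(M \<Otimes>\<^sub>M ?L))"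
    unfolding discounted_def by (rule nn_integral_density) measurable
  also have "\<dots> = (\<integral>\<^sup>+ t. (\<integral>\<^sup>+ \<omega>. ennreal (exp (- r * t)) * ennreal (exp (k * V t \<omega>)) \<partial>M) \<partial>?L)"
    by (subst P.nn_integral_snd[symmetric]) auto
  also have "\<dots> = (\<integral>\<^sup>+ t. ennreal (exp (- (r - k\<^sup>2 / 2) * t)) \<partial>?L)"
  proof (rule nn_integral_cong_AE)
    have "AE t in lborel. t \<noteq> (0::real)"
      by (rule AE_lborel_singleton)
    then have "AE t in ?L. t \<noteq> 0"
      by (subst AE_restrict_space_iff) auto
    then show "AE t in ?L. (\<integral>\<^sup>+ \<omega>. ennreal (exp (- r * t)) * ennreal (exp (k * V t \<omega>)) \<partial>M)
        = ennreal (exp (- (r - k\<^sup>2 / 2) * t))"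
      using AE_space
    proof eventually_elim
      case (elim t)
      then have t: "0 < t" by simp
      have [measurable]: "W t \<in> borel_measurable M"
        using assms(2) t by (intro adapted_measurable) (auto simp: brownian_motion_def)
      have "(\<integral>\<^sup>+ \<omega>. ennreal (exp (- r * t)) * ennreal (exp (k * V t \<omega>)) \<partial>M)
          = (\<integral>\<^sup>+ \<omega>. ennreal (exp (- r * t)) * ennreal (exp (k * W t \<omega>)) \<partial>M)"
        using V(2) by (intro nn_integral_cong_AE) auto
      also have "\<dots> = ennreal (exp (- r * t)) * ennreal (exp (k\<^sup>2 * t / 2))"
        by (simp add: nn_integral_cmult brownian_motion_exp_moment[OF assms(1,2) t])
      also have "\<dots> = ennreal (exp (- (r - k\<^sup>2 / 2) * t))"
      proof -
        have "exp (- r * t) * exp (k\<^sup>2 * t / 2) = exp (- (r - k\<^sup>2 / 2) * t)"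
          by (subst exp_add[symmetric]) (simp add: algebra_simps)
        then show ?thesis
          by (subst ennreal_mult[symmetric]) auto
      qed
      finally show ?case .
    qed
  qed
  also have "\<dots> = (\<integral>\<^sup>+ t\<in>{0..}. ennreal (exp (- (r - k\<^sup>2 / 2) * t)) \<partial>lborel)"
    by (simp add: nn_integral_restrict_space)
  also have "\<dots> = ennreal (1 / (r - k\<^sup>2 / 2))"
    using assms(5) by (intro nn_integral_exp_decay) simp
  finally show ?thesis .
qed

section \<open>Planner optimum and Nash equilibrium\<close>

lemma eq_SUP_iff:
  fixes f :: "'b \<Rightarrow> ennreal"
  assumes "s \<in> S"
  shows "f s = (SUP z\<in>S. f z) \<longleftrightarrow> (\<forall>z\<in>S. f z \<le> f s)"
  using assms by (metis SUP_least SUP_upper order.antisym)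

lemma planner_optimal_iff:
  "planner_optimal M F r \<alpha> \<beta> \<psi>x \<psi>c n w x c \<longleftrightarrow>
    (x, c) \<in> planner_strategies M F r \<psi>x \<psi>c n (real n * w) \<and>
    (\<forall>y d. (y, d) \<in> planner_strategies M F r \<psi>x \<psi>c n (real n * w) \<longrightarrow>
      welfare M r \<alpha> \<beta> n y d \<le> welfare M r \<alpha> \<beta> n x c)"
  unfolding planner_optimal_def
  using eq_SUP_iff[of "(x, c)" "planner_strategies M F r \<psi>x \<psi>c n (real n * w)"
      "\<lambda>(y, d). welfare M r \<alpha> \<beta> n y d"]
  by auto

lemma nash_equilibrium_iff:
  "nash_equilibrium M F r \<alpha> \<beta> \<psi>x \<psi>c n w x c \<longleftrightarrow>
    (\<forall>i<n. (x i, c i) \<in> agent_strategies M F r \<psi>x \<psi>c w \<and>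
      (\<forall>y d. (y, d) \<in> agent_strategies M F r \<psi>x \<psi>c w \<longrightarrow>
        payoff M r \<alpha> \<beta> y d (aggregate_others n i c)
          \<le> payoff M r \<alpha> \<beta> (x i) (c i) (aggregate_others n i c)))"
proof -
  have "payoff M r \<alpha> \<beta> (x i) (c i) (aggregate_others n i c) =
      (SUP (y, d)\<in>agent_strategies M F r \<psi>x \<psi>c w. payoff M r \<alpha> \<beta> y d (aggregate_others n i c))
    \<longleftrightarrow> (\<forall>y d. (y, d) \<in> agent_strategies M F r \<psi>x \<psi>c w \<longrightarrow>
        payoff M r \<alpha> \<beta> y d (aggregate_others n i c)
          \<le> payoff M r \<alpha> \<beta> (x i) (c i) (aggregate_others n i c))"
    if "(x i, c i) \<in> agent_strategies M F r \<psi>x \<psi>c w" for i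
    using eq_SUP_iff[OF that, of "\<lambda>(y, d). payoff M r \<alpha> \<beta> y d (aggregate_others n i c)"] by auto
  then show ?thesis
    unfolding nash_equilibrium_def by blast
qed

lemma sum_others_const:
  fixes a :: real
  assumes "i < n"
  shows "(\<Sum>j\<in>{..<n} - {i}. a) = (real n - 1) * a"
  using assms by (simp add: of_nat_diff)

locale reversible_economy = usual_filtered_prob_space M F
  for M :: "'a measure" and F +
  fixes V \<psi>x \<psi>c :: "real \<Rightarrow> 'a \<Rightarrow> real" and \<alpha> \<beta> r \<sigma> w K :: real and n :: nat
  assumes V_adapted: "adapted F V"
    and V_continuous: "\<And>\<omega>. \<omega> \<in> space M \<Longrightarrow> continuous_on {0..} (\<lambda>t. V t \<omega>)"
    and \<psi>x_eq: "AE \<omega> in M. \<forall>t\<ge>0. \<psi>x t \<omega> = exp (- r * t + \<sigma> * V t \<omega>)"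
    and \<psi>c_eq: "\<psi>c = (\<lambda>t \<omega>. exp (- r * t))"
    and alpha_pos: "0 < \<alpha>" and beta_pos: "0 < \<beta>" and alpha_beta: "\<alpha> + \<beta> < 1" and rate_pos: "0 < r"
    and price_moment_pos: "0 < K"
    and price_moment: "(\<integral>\<^sup>+ p. ennreal (exp (\<sigma> * V (snd p) (fst p)) powr - (\<alpha> / (1 - \<alpha> - \<beta>))) \<partial>discounted M r)
      = ennreal K"
    and w_pos: "0 < w" and n_pos: "1 \<le> n"
begin

lemma V_measurable [measurable]:
  "(\<lambda>p. V (snd p) (fst p)) \<in> borel_measurable (M \<Otimes>\<^sub>M restrict_space lborel {0..})"
  using optional_continuous_function[OF V_adapted V_continuous continuous_on_id]
  by (rule optional_jointly_measurable)

sublocale cobb_douglas "discounted M r" "\<lambda>p. exp (\<sigma> * V (snd p) (fst p))" \<alpha> \<beta> r K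
  by unfold_locales
    (use alpha_pos beta_pos alpha_beta rate_pos price_moment_pos price_moment in auto)

abbreviation on_pairs :: "(real \<Rightarrow> 'a \<Rightarrow> real) \<Rightarrow> 'a \<times> real \<Rightarrow> real" where
  "on_pairs X \<equiv> \<lambda>p. X (snd p) (fst p)"

lemma optional_nonneg_admissible: "optional_nonneg M F X \<Longrightarrow> admissible (on_pairs X)"
  by (auto simp: optional_nonneg_def admissible_def optional_jointly_measurable)

lemma cost_eq:
  assumes "optional_nonneg M F x" "optional_nonneg M F c"
  shows "cost M r \<psi>x \<psi>c x c = expenditure (on_pairs x) (on_pairs c)"
  unfolding expenditure_def \<psi>c_eq
  using assms \<psi>x_eq rate_pos
  by (intro cost_discounted) (auto simp: optional_nonneg_def optional_jointly_measurable)

lemma J_cong: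
  "(\<And>p. p \<in> space M \<times> {0..} \<Longrightarrow> y p = y' p \<and> g p = g' p) \<Longrightarrow> J y g = J y' g'"
  unfolding J_def by (intro nn_integral_cong) auto

lemma payoff_others:
  assumes "optional_nonneg M F y" "optional_nonneg M F d" "\<And>j. j < n \<Longrightarrow> optional_nonneg M F (c j)"
  shows "payoff M r \<alpha> \<beta> y d (aggregate_others n i c)
    = J (on_pairs y) (\<lambda>p. on_pairs d p + (\<Sum>j\<in>{..<n} - {i}. on_pairs (c j) p))"
proof -
  let ?P = "M \<Otimes>\<^sub>M restrict_space lborel {0::real..}"
  have "on_pairs y \<in> borel_measurable ?P" "on_pairs d \<in> borel_measurable ?P"
    "\<And>j. j < n \<Longrightarrow> on_pairs (c j) \<in> borel_measurable ?P"
    using assms by (auto simp: optional_nonneg_def optional_jointly_measurable)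
  moreover from this(3) have "on_pairs (aggregate_others n i c) \<in> borel_measurable ?P"
    unfolding aggregate_others_def by (intro borel_measurable_sum) auto
  ultimately show ?thesis
    unfolding J_def by (simp add: payoff_discounted aggregate_others_def)
qed

lemma payoff_own:
  assumes "i < n" "\<And>j. j < n \<Longrightarrow> optional_nonneg M F (x j) \<and> optional_nonneg M F (c j)"
  shows "payoff M r \<alpha> \<beta> (x i) (c i) (aggregate_others n i c)
    = J (on_pairs (x i)) (\<lambda>p. \<Sum>j<n. on_pairs (c j) p)"
proof -
  have "on_pairs (c i) p + (\<Sum>j\<in>{..<n} - {i}. on_pairs (c j) p) = (\<Sum>j<n. on_pairs (c j) p)" for p
    using assms(1) by (subst sum.remove[of _ i]) auto
  then show ?thesis
    using assms by (subst payoff_others) auto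
qed

lemma optional_nonneg_cmult:
  assumes "optional_nonneg M F X" "0 \<le> k"
  shows "optional_nonneg M F (\<lambda>t \<omega>. k * X t \<omega>)"
  using assms by (auto simp: optional_nonneg_def optional_def)

lemma optional_nonneg_add:
  assumes "optional_nonneg M F X" "optional_nonneg M F Y"
  shows "optional_nonneg M F (\<lambda>t \<omega>. X t \<omega> + Y t \<omega>)"
  using assms by (auto simp: optional_nonneg_def optional_def)

lemma optional_nonneg_opt:
  assumes "0 < m"
  shows "optional_nonneg M F (\<lambda>t \<omega>. opt_x m (\<omega>, t))" "optional_nonneg M F (\<lambda>t \<omega>. opt_c m (\<omega>, t))"
proof -
  have "continuous_on UNIV (\<lambda>v. \<alpha> * m / ((\<alpha> + \<beta>) * K)
      * (exp (\<sigma> * v) powr - (\<alpha> / (1 - \<alpha> - \<beta>)) / exp (\<sigma> * v)))"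
    by (intro continuous_intros) auto
  from optional_continuous_function[OF V_adapted V_continuous this]
  have "optional M F (\<lambda>t \<omega>. opt_x m (\<omega>, t))"
    by (simp add: opt_x_def Z_def)
  then show "optional_nonneg M F (\<lambda>t \<omega>. opt_x m (\<omega>, t))"
    using opt_pos(1)[OF assms] by (simp add: optional_nonneg_def less_imp_le)
  have "continuous_on UNIV (\<lambda>v. \<beta> * m / ((\<alpha> + \<beta>) * r * K)
      * exp (\<sigma> * v) powr - (\<alpha> / (1 - \<alpha> - \<beta>)))"
    by (intro continuous_intros) auto
  from optional_continuous_function[OF V_adapted V_continuous this]
  have "optional M F (\<lambda>t \<omega>. opt_c m (\<omega>, t))"
    by (simp add: opt_c_def Z_def)
  then show "optional_nonneg M F (\<lambda>t \<omega>. opt_c m (\<omega>, t))"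
    using opt_pos(2)[OF assms] by (simp add: optional_nonneg_def less_imp_le)
qed

lemma welfare_eq:
  assumes "\<And>i. i < n \<Longrightarrow> optional_nonneg M F (x i) \<and> optional_nonneg M F (c i)"
  shows "welfare M r \<alpha> \<beta> n x c
    = (\<Sum>i<n. ennreal (1 / real n) * J (on_pairs (x i)) (\<lambda>p. \<Sum>j<n. on_pairs (c j) p))"
  unfolding welfare_def using payoff_own assms by (intro sum.cong) auto

lemma planner_strategies_iff:
  "(x, c) \<in> planner_strategies M F r \<psi>x \<psi>c n b \<longleftrightarrow>
    (\<forall>i<n. optional_nonneg M F (x i) \<and> optional_nonneg M F (c i)) \<and>
    expenditure (\<lambda>p. \<Sum>i<n. on_pairs (x i) p) (\<lambda>p. \<Sum>i<n. on_pairs (c i) p) \<le> ennreal b"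
proof -
  have "(\<Sum>i<n. cost M r \<psi>x \<psi>c (x i) (c i))
      = expenditure (\<lambda>p. \<Sum>i<n. on_pairs (x i) p) (\<lambda>p. \<Sum>i<n. on_pairs (c i) p)"
    if "\<forall>i<n. optional_nonneg M F (x i) \<and> optional_nonneg M F (c i)"
    using that by (subst expenditure_sum[symmetric]) (auto simp: cost_eq optional_nonneg_admissible)
  then show ?thesis
    by (auto simp: planner_strategies_def)
qed

lemma welfare_le:
  assumes "(x, c) \<in> planner_strategies M F r \<psi>x \<psi>c n b"
  shows "welfare M r \<alpha> \<beta> n x c
    \<le> ennreal (real n powr - \<alpha>) * J (\<lambda>p. \<Sum>i<n. on_pairs (x i) p) (\<lambda>p. \<Sum>j<n. on_pairs (c j) p)"
proof -
  have xc: "\<And>i. i < n \<Longrightarrow> optional_nonneg M F (x i) \<and> optional_nonneg M F (c i)"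
    using assms by (auto simp: planner_strategies_iff)
  then have "welfare M r \<alpha> \<beta> n x c
      = (\<Sum>i<n. ennreal (1 / real n) * J (on_pairs (x i)) (\<lambda>p. \<Sum>j<n. on_pairs (c j) p))"
    by (rule welfare_eq)
  also have "\<dots> \<le> ennreal (real n powr - \<alpha>)
      * J (\<lambda>p. \<Sum>i<n. on_pairs (x i) p) (\<lambda>p. \<Sum>j<n. on_pairs (c j) p)"
    using xc by (intro planner_bound n_pos admissible_sum optional_nonneg_admissible) auto
  finally show ?thesis .
qed

definition planner_x :: "nat \<Rightarrow> real \<Rightarrow> 'a \<Rightarrow> real" where
  "planner_x i t \<omega> = 1 / real n * opt_x (real n * w) (\<omega>, t)"

definition planner_c :: "nat \<Rightarrow> real \<Rightarrow> 'a \<Rightarrow> real" where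
  "planner_c i t \<omega> = 1 / real n * opt_c (real n * w) (\<omega>, t)"

lemma planner_budget_pos: "0 < real n * w"
  using n_pos w_pos by simp

lemma planner_candidate:
  shows "(planner_x, planner_c) \<in> planner_strategies M F r \<psi>x \<psi>c n (real n * w)"
    and "welfare M r \<alpha> \<beta> n planner_x planner_c
      = ennreal (real n powr - \<alpha>) * J (opt_x (real n * w)) (opt_c (real n * w))"
proof -
  have opt: "optional_nonneg M F (planner_x i) \<and> optional_nonneg M F (planner_c i)" for i
    unfolding planner_x_def[abs_def] planner_c_def[abs_def]
    by (intro conjI optional_nonneg_cmult optional_nonneg_opt planner_budget_pos) auto
  have sums: "(\<lambda>p. \<Sum>i<n. on_pairs (planner_x i) p) = opt_x (real n * w)"
    "(\<lambda>p. \<Sum>i<n. on_pairs (planner_c i) p) = opt_c (real n * w)"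
    using n_pos by (auto simp: planner_x_def planner_c_def)
  show "(planner_x, planner_c) \<in> planner_strategies M F r \<psi>x \<psi>c n (real n * w)"
    using opt by (simp add: planner_strategies_iff sums expenditure_opt planner_budget_pos)
  have "on_pairs (planner_x i) = (\<lambda>p. opt_x (real n * w) p / real n)" for i
    by (simp add: planner_x_def)
  then have "welfare M r \<alpha> \<beta> n planner_x planner_c
      = (\<Sum>i<n. ennreal (1 / real n) * J (\<lambda>p. opt_x (real n * w) p / real n) (opt_c (real n * w)))"
    by (simp only: welfare_eq[OF opt] sums)
  then show "welfare M r \<alpha> \<beta> n planner_x planner_c
      = ennreal (real n powr - \<alpha>) * J (opt_x (real n * w)) (opt_c (real n * w))"
    by (simp only: planner_equal_shares[OF n_pos admissible_opt[OF planner_budget_pos]])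
qed

lemma planner_strategy_bounds:
  assumes "(x, c) \<in> planner_strategies M F r \<psi>x \<psi>c n (real n * w)"
  shows "admissible (\<lambda>p. \<Sum>i<n. on_pairs (x i) p)" "admissible (\<lambda>p. \<Sum>i<n. on_pairs (c i) p)"
    "expenditure (\<lambda>p. \<Sum>i<n. on_pairs (x i) p) (\<lambda>p. \<Sum>i<n. on_pairs (c i) p) \<le> ennreal (real n * w)"
proof -
  have xc: "\<And>i. i < n \<Longrightarrow> admissible (on_pairs (x i)) \<and> admissible (on_pairs (c i))"
    using assms by (auto simp: planner_strategies_iff optional_nonneg_admissible)
  show "admissible (\<lambda>p. \<Sum>i<n. on_pairs (x i) p)"
    by (rule admissible_sum) (simp add: xc)
  show "admissible (\<lambda>p. \<Sum>i<n. on_pairs (c i) p)"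
    by (rule admissible_sum) (simp add: xc)
  show "expenditure (\<lambda>p. \<Sum>i<n. on_pairs (x i) p) (\<lambda>p. \<Sum>i<n. on_pairs (c i) p) \<le> ennreal (real n * w)"
    using assms by (simp add: planner_strategies_iff)
qed

lemma planner_optimal_exists:
  "planner_optimal M F r \<alpha> \<beta> \<psi>x \<psi>c n w planner_x planner_c"
  unfolding planner_optimal_iff
proof (intro conjI allI impI)
  fix y d assume yd: "(y, d) \<in> planner_strategies M F r \<psi>x \<psi>c n (real n * w)"
  have "welfare M r \<alpha> \<beta> n y d \<le> ennreal (real n powr - \<alpha>) * J (opt_x (real n * w)) (opt_c (real n * w))"
    using welfare_le[OF yd] J_le_opt[OF planner_budget_pos planner_strategy_bounds[OF yd]]
    by (meson mult_left_mono order.trans zero_le)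
  then show "welfare M r \<alpha> \<beta> n y d \<le> welfare M r \<alpha> \<beta> n planner_x planner_c"
    by (simp only: planner_candidate(2))
qed (rule planner_candidate)

lemma planner_optimal_aggregate:
  assumes "planner_optimal M F r \<alpha> \<beta> \<psi>x \<psi>c n w x c"
  shows "AE p in discounted M r. aggregate n c (snd p) (fst p) = opt_c (real n * w) p"
proof -
  have xc: "(x, c) \<in> planner_strategies M F r \<psi>x \<psi>c n (real n * w)"
    and best: "welfare M r \<alpha> \<beta> n planner_x planner_c \<le> welfare M r \<alpha> \<beta> n x c"
    using assms planner_candidate(1) by (auto simp: planner_optimal_iff)
  have "ennreal (real n powr - \<alpha>) * J (opt_x (real n * w)) (opt_c (real n * w))
      \<le> ennreal (real n powr - \<alpha>) * J (\<lambda>p. \<Sum>i<n. on_pairs (x i) p) (\<lambda>p. \<Sum>j<n. on_pairs (c j) p)"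
    using best welfare_le[OF xc] unfolding planner_candidate(2) by (rule order.trans)
  then have "J (opt_x (real n * w)) (opt_c (real n * w))
      \<le> J (\<lambda>p. \<Sum>i<n. on_pairs (x i) p) (\<lambda>p. \<Sum>j<n. on_pairs (c j) p)"
    using n_pos by (subst (asm) ennreal_mult_le_mult_iff) auto
  from opt_unique[OF planner_budget_pos planner_strategy_bounds[OF xc] this] show ?thesis
    by (auto simp: aggregate_def)
qed

lemma agent_strategies_iff:
  "(x, c) \<in> agent_strategies M F r \<psi>x \<psi>c w \<longleftrightarrow>
    optional_nonneg M F x \<and> optional_nonneg M F c \<and> expenditure (on_pairs x) (on_pairs c) \<le> ennreal w"
  by (auto simp: agent_strategies_def cost_eq)

definition nash_x :: "nat \<Rightarrow> real \<Rightarrow> 'a \<Rightarrow> real" where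
  "nash_x i t \<omega> = opt_x (nash_budget n w) (\<omega>, t)"

definition nash_c :: "nat \<Rightarrow> real \<Rightarrow> 'a \<Rightarrow> real" where
  "nash_c i t \<omega> = 1 / real n * opt_c (nash_budget n w) (\<omega>, t)"

lemma symmetric_nash_exists:
  "symmetric_nash_equilibrium M F r \<alpha> \<beta> \<psi>x \<psi>c n w nash_x nash_c"
  unfolding symmetric_nash_equilibrium_def nash_equilibrium_iff
proof (intro conjI allI impI ballI)
  let ?m = "nash_budget n w"
  have m: "0 < ?m"
    using n_pos w_pos by (rule nash_budget_pos)
  have opt: "optional_nonneg M F (nash_x i)" "optional_nonneg M F (nash_c i)" for i
    unfolding nash_x_def[abs_def] nash_c_def[abs_def]
    by (intro optional_nonneg_cmult optional_nonneg_opt m; simp)+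
  have pairs: "on_pairs (nash_x i) = opt_x ?m" "on_pairs (nash_c i) = (\<lambda>p. opt_c ?m p / real n)" for i
    by (simp_all add: nash_x_def nash_c_def)
  fix i assume i: "i < n"
  show "(nash_x i, nash_c i) \<in> agent_strategies M F r \<psi>x \<psi>c w"
    using opt nash_feasible[OF n_pos w_pos] by (simp add: agent_strategies_iff pairs)
  fix y d assume "(y, d) \<in> agent_strategies M F r \<psi>x \<psi>c w"
  then have yd: "optional_nonneg M F y" "optional_nonneg M F d"
    "expenditure (on_pairs y) (on_pairs d) \<le> ennreal w"
    by (auto simp: agent_strategies_iff)
  have "payoff M r \<alpha> \<beta> y d (aggregate_others n i nash_c)
      = J (on_pairs y) (\<lambda>p. on_pairs d p + (\<Sum>j\<in>{..<n} - {i}. on_pairs (nash_c j) p))"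
    using yd opt by (intro payoff_others) auto
  also have "\<dots> = J (on_pairs y) (\<lambda>p. on_pairs d p + (real n - 1) * (opt_c ?m p / real n))"
  proof -
    have "(\<Sum>j\<in>{..<n} - {i}. on_pairs (nash_c j) p) = (real n - 1) * (opt_c ?m p / real n)" for p
      using sum_others_const[OF i, of "opt_c ?m p / real n"] by (simp add: nash_c_def)
    then show ?thesis by simp
  qed
  also have "\<dots> \<le> J (opt_x ?m) (opt_c ?m)"
    using yd by (intro nash_best_response n_pos w_pos optional_nonneg_admissible)
  also have "\<dots> = payoff M r \<alpha> \<beta> (nash_x i) (nash_c i) (aggregate_others n i nash_c)"
    using n_pos opt by (subst payoff_own[OF i]) (simp_all add: pairs(1) nash_c_def)
  finally show "payoff M r \<alpha> \<beta> y d (aggregate_others n i nash_c)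
      \<le> payoff M r \<alpha> \<beta> (nash_x i) (nash_c i) (aggregate_others n i nash_c)" .
qed (simp_all add: nash_x_def nash_c_def)

lemma symmetric_nash_aggregate:
  assumes "symmetric_nash_equilibrium M F r \<alpha> \<beta> \<psi>x \<psi>c n w x c"
  shows "AE p in discounted M r. aggregate n c (snd p) (fst p) = opt_c (nash_budget n w) p"
proof -
  have zero: "0 < n" using n_pos by simp
  have "nash_equilibrium M F r \<alpha> \<beta> \<psi>x \<psi>c n w x c"
    using assms unfolding symmetric_nash_equilibrium_def by (rule conjunct1)
  then have strategies: "\<And>i. i < n \<Longrightarrow> (x i, c i) \<in> agent_strategies M F r \<psi>x \<psi>c w"
    and best: "\<And>y d. (y, d) \<in> agent_strategies M F r \<psi>x \<psi>c w \<Longrightarrow>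
      payoff M r \<alpha> \<beta> y d (aggregate_others n 0 c) \<le> payoff M r \<alpha> \<beta> (x 0) (c 0) (aggregate_others n 0 c)"
    using zero unfolding nash_equilibrium_iff by blast+
  have opt: "optional_nonneg M F (x i)" "optional_nonneg M F (c i)" if "i < n" for i
    using strategies[OF that] by (simp_all add: agent_strategies_iff)
  have cost0: "expenditure (on_pairs (x 0)) (on_pairs (c 0)) \<le> ennreal w"
    using strategies[OF zero] by (simp add: agent_strategies_iff)
  have symmetric: "c j t \<omega> = c 0 t \<omega>" if "j < n" "\<omega> \<in> space M" "0 \<le> t" for j t \<omega>
  proof -
    have "\<forall>i<n. \<forall>j<n. \<forall>\<omega>\<in>space M. \<forall>t\<ge>0. x i t \<omega> = x j t \<omega> \<and> c i t \<omega> = c j t \<omega>"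
      using assms unfolding symmetric_nash_equilibrium_def by (rule conjunct2)
    from this[rule_format, OF that(1) zero that(2,3)] show ?thesis ..
  qed
  have sums: "(\<Sum>j\<in>A. on_pairs (c j) p) = real (card A) * on_pairs (c 0) p"
    if "A \<subseteq> {..<n}" "p \<in> space M \<times> {0..}" for A p
  proof -
    have "(\<Sum>j\<in>A. on_pairs (c j) p) = (\<Sum>j\<in>A. on_pairs (c 0) p)"
      using that by (intro sum.cong[OF refl] symmetric) auto
    then show ?thesis by simp
  qed
  have own: "payoff M r \<alpha> \<beta> (x 0) (c 0) (aggregate_others n 0 c)
      = J (on_pairs (x 0)) (\<lambda>p. real n * on_pairs (c 0) p)"
  proof -
    have "payoff M r \<alpha> \<beta> (x 0) (c 0) (aggregate_others n 0 c)
        = J (on_pairs (x 0)) (\<lambda>p. \<Sum>j<n. on_pairs (c j) p)"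
      using opt by (intro payoff_own zero) auto
    also have "\<dots> = J (on_pairs (x 0)) (\<lambda>p. real n * on_pairs (c 0) p)"
      by (rule J_cong) (use sums[OF order_refl] in simp)
    finally show ?thesis .
  qed
  have others: "payoff M r \<alpha> \<beta> y d (aggregate_others n 0 c)
      = J (on_pairs y) (\<lambda>p. on_pairs d p + (real n - 1) * on_pairs (c 0) p)"
    if "optional_nonneg M F y" "optional_nonneg M F d" for y d
  proof -
    have "real (card ({..<n} - {0})) = real n - 1"
      using zero by (simp add: of_nat_diff)
    then have "(\<Sum>j\<in>{..<n} - {0}. on_pairs (c j) p) = (real n - 1) * on_pairs (c 0) p"
      if "p \<in> space M \<times> {0..}" for p
      using sums[OF Diff_subset that] by simp
    then show ?thesis
      using that opt by (subst payoff_others) (auto intro!: J_cong)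
  qed
  have "AE p in discounted M r. real n * on_pairs (c 0) p = opt_c (nash_budget n w) p"
  proof (rule nash_unique[OF n_pos w_pos optional_nonneg_admissible[OF opt(1)[OF zero]]
        optional_nonneg_admissible[OF opt(2)[OF zero]] cost0])
    fix m y d
    assume m: "0 < m"
      and y: "y = (\<lambda>p. (1 - 1 / real n) * on_pairs (x 0) p + 1 / real n * opt_x m p)"
      and d: "d = (\<lambda>p. 1 / real n * opt_c m p)"
      and cost: "expenditure y d \<le> ennreal w"
    define Y D where "Y t \<omega> = (1 - 1 / real n) * x 0 t \<omega> + 1 / real n * opt_x m (\<omega>, t)"
      and "D t \<omega> = 1 / real n * opt_c m (\<omega>, t)" for t \<omega>
    have YD: "optional_nonneg M F Y" "optional_nonneg M F D"
      unfolding Y_def[abs_def] D_def[abs_def] using n_pos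
      by (intro optional_nonneg_add optional_nonneg_cmult optional_nonneg_opt m opt zero; simp)+
    have yd: "y = on_pairs Y" "d = on_pairs D"
      by (auto simp: y d Y_def D_def)
    show "J y (\<lambda>p. d p + (real n - 1) * on_pairs (c 0) p) \<le> J (on_pairs (x 0)) (\<lambda>p. real n * on_pairs (c 0) p)"
      using best[of Y D] YD cost by (simp add: agent_strategies_iff yd own others)
  qed
  then show ?thesis
    using AE_space
  proof eventually_elim
    case (elim p)
    then have "aggregate n c (snd p) (fst p) = real n * on_pairs (c 0) p"
      unfolding aggregate_def using sums[OF order_refl, of p] by simp
    then show ?case
      using elim(1) by simp
  qed
qed

lemma aggregate_ratio:
  assumes "planner_optimal M F r \<alpha> \<beta> \<psi>x \<psi>c n w x_opt c_opt"
    and "symmetric_nash_equilibrium M F r \<alpha> \<beta> \<psi>x \<psi>c n w x_nash c_nash"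
  shows "AE (\<omega>, t) in M \<Otimes>\<^sub>M restrict_space lborel {0..}.
    aggregate n c_nash t \<omega> / aggregate n c_opt t \<omega> = (\<alpha> + \<beta>) / (real n * \<alpha> + \<beta>)"
proof -
  have "AE p in discounted M r. aggregate n c_nash (snd p) (fst p) / aggregate n c_opt (snd p) (fst p)
      = (\<alpha> + \<beta>) / (real n * \<alpha> + \<beta>)"
    using planner_optimal_aggregate[OF assms(1)] symmetric_nash_aggregate[OF assms(2)]
  proof eventually_elim
    case (elim p)
    have "opt_c (nash_budget n w) p / opt_c (real n * w) p = nash_budget n w / (real n * w)"
      using alpha_pos beta_pos rate_pos price_moment_pos Z_pos[of p] planner_budget_pos
      by (simp add: opt_c_def)
    then show ?case
      using elim n_pos w_pos by (simp add: nash_budget_def)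
  qed
  then show ?thesis
    by (simp add: AE_discounted case_prod_beta)
qed

end

theorem proposition5p8:
  fixes M :: "'a measure" and F :: "real \<Rightarrow> 'a measure"
    and W \<psi>x \<psi>c :: "real \<Rightarrow> 'a \<Rightarrow> real"
    and r \<alpha> \<beta> \<sigma> w :: real and n :: nat
  assumes "usual_filtered_prob_space M F"
    and "brownian_motion M F W"
    and "0 < \<alpha>" "\<alpha> < 1" "0 < \<beta>" "\<beta> < 1" "\<alpha> + \<beta> < 1"
    and "0 < w" "0 < \<sigma>" "0 < r"
    and "sqrt (2 * r) > \<sigma> * \<alpha> / (1 - \<alpha> - \<beta>)"
    and "1 \<le> n"
    and \<psi>x_def: "\<psi>x = (\<lambda>t \<omega>. exp (- r * t + \<sigma> * W t \<omega>))"
    and \<psi>c_def: "\<psi>c = (\<lambda>t \<omega>. exp (- r * t))"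
  shows "(\<exists>x c. planner_optimal M F r \<alpha> \<beta> \<psi>x \<psi>c n w x c) \<and>
    (\<exists>x c. symmetric_nash_equilibrium M F r \<alpha> \<beta> \<psi>x \<psi>c n w x c) \<and>
    (\<forall>x_opt c_opt x_nash c_nash.
       planner_optimal M F r \<alpha> \<beta> \<psi>x \<psi>c n w x_opt c_opt \<longrightarrow>
       symmetric_nash_equilibrium M F r \<alpha> \<beta> \<psi>x \<psi>c n w x_nash c_nash \<longrightarrow>
       (AE (\<omega>, t) in M \<Otimes>\<^sub>M restrict_space lborel {0..}.
          aggregate n c_nash t \<omega> / aggregate n c_opt t \<omega> = (\<alpha> + \<beta>) / (real n * \<alpha> + \<beta>)))"
proof -
  interpret usual_filtered_prob_space M F by fact
  obtain V where V: "adapted F V" "\<And>\<omega>. \<omega> \<in> space M \<Longrightarrow> continuous_on {0..} (\<lambda>t. V t \<omega>)"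
    "AE \<omega> in M. \<forall>t. V t \<omega> = W t \<omega>"
    using brownian_motion_continuous_version[OF assms(1,2)] by metis
  define k where "k = - (\<sigma> * \<alpha> / (1 - \<alpha> - \<beta>))"
  have "(\<sigma> * \<alpha> / (1 - \<alpha> - \<beta>))\<^sup>2 < (sqrt (2 * r))\<^sup>2"
    using assms by (intro power_strict_mono) auto
  then have k: "k\<^sup>2 < 2 * r"
    using assms(10) by (simp add: k_def)
  have "exp (\<sigma> * v) powr - (\<alpha> / (1 - \<alpha> - \<beta>)) = exp (k * v)" for v
    by (simp add: exp_powr_real k_def)
  moreover have "(\<lambda>p. V (snd p) (fst p)) \<in> borel_measurable (M \<Otimes>\<^sub>M restrict_space lborel {0..})"
    using optional_continuous_function[OF V(1,2) continuous_on_id] by (rule optional_jointly_measurable)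
  ultimately have moment: "(\<integral>\<^sup>+ p. ennreal (exp (\<sigma> * V (snd p) (fst p)) powr - (\<alpha> / (1 - \<alpha> - \<beta>))) \<partial>discounted M r)
      = ennreal (1 / (r - k\<^sup>2 / 2))"
    using discounted_exp_moment[OF assms(1,2) _ V(3) k] by simp
  have price: "AE \<omega> in M. \<forall>t\<ge>0. \<psi>x t \<omega> = exp (- r * t + \<sigma> * V t \<omega>)"
    using V(3) by eventually_elim (simp add: \<psi>x_def)
  interpret reversible_economy M F V \<psi>x \<psi>c \<alpha> \<beta> r \<sigma> w "1 / (r - k\<^sup>2 / 2)" n
    by unfold_locales (use V(1,2) price \<psi>c_def assms(3-12) moment k in auto)
  show ?thesis
    using planner_optimal_exists symmetric_nash_exists aggregate_ratio by blast
qed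

end
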